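(* Let $f=\sum_{\sigma\in S_d}\lambda_\sigma x_{\sigma(1)}\cdots x_{\sigma(d)}\in \mathbb C\langle X\rangle$ be a multilinear polynomial of degree $d\ge 2$ such that $\sum_{\sigma\in S_d}\lambda_\sigma=0$ and $\sum_{\sigma\in S_d,\ \sigma^{-1}(1)<\sigma^{-1}(2)}\lambda_\sigma\neq 0$. Let $\mathcal A$ be a unital prime $C^*$-algebra that is not isomorphic to $M_2(\mathbb C)$. If $\phi:\mathcal A\to\mathcal A$ is a continuous bijective linear map that preserves zeros of $f$ and satisfies $\phi(1)\in\mathbb C^*\cdot 1$, then there exist $\alpha\in\mathbb C$, an automorphism or antiautomorphism $\theta$ of $\mathcal A$, and a linear functional $\omega$ on $\mathcal A$ such that $\phi(a)=\alpha\theta(a)+\omega(a)1$ for all $a\in\mathcal A$.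
   Context: $\mathbb C\langle X\rangle$ is the free algebra over $\mathbb C$ in noncommuting indeterminates $x_1,x_2,\ldots$. A map $\phi$ on $\mathcal A$ preserves zeros of $f$ if for all $a_1,\ldots,a_d\in\mathcal A$, $f(a_1,\ldots,a_d)=0$ implies $f(\phi(a_1),\ldots,\phi(a_d))=0$. *)

theory Defs
  imports "HOL-Analysis.Analysis"
begin

definition cstar_algebra :: "(complex \<Rightarrow> 'a::{banach,real_normed_algebra_1} \<Rightarrow> 'a) \<Rightarrow> ('a \<Rightarrow> 'a) \<Rightarrow> bool" where
  "cstar_algebra cs st \<longleftrightarrow>
     (\<forall>r x. cs (complex_of_real r) x = r *\<^sub>R x) \<and>
     (\<forall>a b x. cs (a + b) x = cs a x + cs b x) \<and>
     (\<forall>a x y. cs a (x + y) = cs a x + cs a y) \<and>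
     (\<forall>a b x. cs (a * b) x = cs a (cs b x)) \<and>
     (\<forall>a x y. cs a (x * y) = cs a x * y \<and> cs a (x * y) = x * cs a y) \<and>
     (\<forall>a x. norm (cs a x) = cmod a * norm x) \<and>
     (\<forall>x. st (st x) = x) \<and>
     (\<forall>x y. st (x + y) = st x + st y) \<and>
     (\<forall>a x. st (cs a x) = cs (cnj a) (st x)) \<and>
     (\<forall>x y. st (x * y) = st y * st x) \<and>
     (\<forall>x. norm (st x * x) = (norm x)\<^sup>2)"

definition prime_algebra :: "'a::ring itself \<Rightarrow> bool" where
  "prime_algebra _ \<longleftrightarrow> (\<forall>a b::'a. (\<forall>x. a * x * b = 0) \<longrightarrow> a = 0 \<or> b = 0)"

definition clinear_map :: "(complex \<Rightarrow> 'a \<Rightarrow> 'a) \<Rightarrow> (complex \<Rightarrow> 'b \<Rightarrow> 'b) \<Rightarrow> ('a::plus \<Rightarrow> 'b::plus) \<Rightarrow> bool" where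
  "clinear_map csa csb g \<longleftrightarrow> (\<forall>x y. g (x + y) = g x + g y) \<and> (\<forall>c x. g (csa c x) = csb c (g x))"

definition iso_M2 :: "(complex \<Rightarrow> 'a \<Rightarrow> 'a) \<Rightarrow> ('a::{plus,times}) itself \<Rightarrow> bool" where
  "iso_M2 cs _ \<longleftrightarrow> (\<exists>h :: 'a \<Rightarrow> complex^2^2. bij h \<and> clinear_map cs (\<lambda>c M. \<chi> i j. c * M $ i $ j) h \<and>
       (\<forall>x y. h (x * y) = h x ** h y))"

definition automorphism :: "(complex \<Rightarrow> 'a \<Rightarrow> 'a) \<Rightarrow> ('a::{plus,times} \<Rightarrow> 'a) \<Rightarrow> bool" where
  "automorphism cs \<theta> \<longleftrightarrow> bij \<theta> \<and> clinear_map cs cs \<theta> \<and> (\<forall>x y. \<theta> (x * y) = \<theta> x * \<theta> y)"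

definition antiautomorphism :: "(complex \<Rightarrow> 'a \<Rightarrow> 'a) \<Rightarrow> ('a::{plus,times} \<Rightarrow> 'a) \<Rightarrow> bool" where
  "antiautomorphism cs \<theta> \<longleftrightarrow> bij \<theta> \<and> clinear_map cs cs \<theta> \<and> (\<forall>x y. \<theta> (x * y) = \<theta> y * \<theta> x)"

definition mlpoly_eval :: "(complex \<Rightarrow> 'a \<Rightarrow> 'a) \<Rightarrow> nat \<Rightarrow> ((nat \<Rightarrow> nat) \<Rightarrow> complex) \<Rightarrow> (nat \<Rightarrow> 'a::{monoid_mult,comm_monoid_add}) \<Rightarrow> 'a" where
  "mlpoly_eval cs d lam a = (\<Sum>\<sigma>\<in>{\<sigma>. \<sigma> permutes {1..d}}. cs (lam \<sigma>) (prod_list (map (\<lambda>i. a (\<sigma> i)) [1..<d+1])))"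

definition preserves_zeros :: "(complex \<Rightarrow> 'a::{monoid_mult,comm_monoid_add} \<Rightarrow> 'a) \<Rightarrow> nat \<Rightarrow> ((nat \<Rightarrow> nat) \<Rightarrow> complex) \<Rightarrow> ('a \<Rightarrow> 'a) \<Rightarrow> bool" where
  "preserves_zeros cs d lam \<phi> \<longleftrightarrow>
     (\<forall>a::nat \<Rightarrow> 'a. mlpoly_eval cs d lam a = 0 \<longrightarrow> mlpoly_eval cs d lam (\<phi> \<circ> a) = 0)"

end

theory Submission
  imports Defs
begin

text \<open>Substituting \<open>1\<close> for all but two variables shows that \<open>\<phi>\<close> preserves commutativity, so after
  scaling \<open>\<phi> 1 = 1\<close> the product \<open>B(x, y) = \<phi>(\<phi>\<^sup>-\<^sup>1 x \<circ> \<phi>\<^sup>-\<^sup>1 y)\<close> satisfies \<open>[B(x, x), x] = 0\<close> and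
  \<open>B(x, 1) = x\<close>. If some \<open>t\<close> is not quadratic over the complex numbers, then
  \<open>B(x, x) = \<kappa> x\<^sup>2 + \<mu>(x) x + \<nu>(x)\<close> as in Bresar's theorem on commuting traces, and a multiple of \<open>\<phi>\<close>
  plus a functional is a Jordan homomorphism, hence a homomorphism or an antihomomorphism by
  Herstein's theorem. If all elements are quadratic, the algebra is the complex field or the algebra
  of 2-by-2 matrices. The only analytic input is that the extended centroid of a prime \<open>C\<^sup>*\<close>-algebra
  is trivial: \<open>a x b = b x a\<close> for all \<open>x\<close> implies that \<open>b\<close> is a multiple of \<open>a \<noteq> 0\<close>.\<close>

section \<open>Centrally closed prime algebras\<close>

text \<open>The obstacle is quadratic elements: if \<open>t * t\<close> is a combination of
  \<open>t\<close> and \<open>1\<close>, coefficients in an identity for B(t, t) cannot be compared,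
  and by Cayley-Hamilton this happens for every 2-by-2 matrix. Non-quadraticity is stored as one
  nonzero value of \<open>capelli\<close>, which scales under affine substitutions and is
  continuous, so it survives the passage from \<phi> to \<theta> and small perturbations. The
  functional arises from completing the square: if \<phi>(a^2) = \<kappa> \<phi>(a)^2 + m(a)
  \<phi>(a) + \<nu>(a), then \<theta> = \<kappa> \<phi> + m/2 respects squares up to a scalar e(a),
  which a perturbation argument removes. On the analytic side, functional calculus is replaced by
  square roots obtained from an iteration; the condition norm (1 - h) \<le> 1 stands in for
  positivity of h.\<close>

locale complex_algebra = vector_space cs
  for cs :: "complex \<Rightarrow> 'a::ring_1 \<Rightarrow> 'a" +
  assumes cs_mult_left [simp]: "cs c x * y = cs c (x * y)"
    and cs_mult_right [simp]: "x * cs c y = cs c (x * y)"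
begin

lemma double_eq_0:
  fixes x :: 'a
  shows "x + x = 0 \<Longrightarrow> x = 0"
proof -
  assume "x + x = 0"
  then have "cs 2 x = 0"
    using scale_left_distrib [of 1 1 x] by simp
  then show "x = 0"
    by simp
qed

end

text \<open>Vanishes for all \<open>x y z\<close> if and only if \<open>1, t, u\<close> are linearly dependent (for \<open>t\<close> not scalar).
  As a function of \<open>u\<close> it has the form \<open>\<Sum> a\<^sub>i u b\<^sub>i\<close> and annihilates \<open>1\<close> and \<open>t\<close>.\<close>
definition capelli :: "'a::ring \<Rightarrow> 'a \<Rightarrow> 'a \<Rightarrow> 'a \<Rightarrow> 'a \<Rightarrow> 'a" where
  "capelli t u x y z = (t * x - x * t) * y * (u * z - z * u) - (u * x - x * u) * y * (t * z - z * t)"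

text \<open>The last assumption says that the extended centroid consists of the scalars.\<close>
locale centrally_closed_prime = complex_algebra cs
  for cs :: "complex \<Rightarrow> 'a::ring_1 \<Rightarrow> 'a" +
  assumes prime: "(\<And>x. a * x * b = 0) \<Longrightarrow> a = 0 \<or> b = 0"
    and centrally_closed: "a \<noteq> 0 \<Longrightarrow> (\<And>x. a * x * b = b * x * a) \<Longrightarrow> \<exists>c. b = cs c a"
begin

text \<open>If every other \<open>c i\<close> satisfies the exchange relation with
  \<open>c k\<close>, it is a multiple of \<open>c k\<close>, and primeness finishes. Otherwise,
  comparing the identity at \<open>x * c k * y\<close> with the identity at \<open>x\<close>
  multiplied by \<open>y * c k\<close> cancels the \<open>k\<close>-th term; induction expresses
  some \<open>v j\<close> by the rest, and eliminating it shortens the original identity.\<close>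

lemma generalized_polynomial_identity:
  assumes "finite I" "k \<in> I" "\<And>x. (\<Sum>i\<in>I. v i * x * c i) = 0" "c k \<noteq> 0"
  shows "\<exists>\<beta>. v k = (\<Sum>i\<in>I - {k}. cs (\<beta> i) (v i))"
  using assms
proof (induction "card I" arbitrary: I k c rule: less_induct)
  case less
  let ?J = "I - {k}"
  have fJ: "finite ?J" and cJ: "card ?J < card I"
    using less.prems(1,2) by (auto simp del: card_Diff_insert card_Diff_singleton intro: card_Diff1_less)
  have split: "v k * x * c k = - (\<Sum>i\<in>?J. v i * x * c i)" for x
    using less.prems(3) [of x] sum.remove [OF less.prems(1,2), of "\<lambda>i. v i * x * c i"]
    by (simp add: eq_neg_iff_add_eq_0)
  show ?case
  proof (cases "\<forall>i\<in>?J. \<forall>y. c k * y * c i = c i * y * c k")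
    case True
    then have "\<forall>i\<in>?J. \<exists>b. c i = cs b (c k)"
      using centrally_closed [OF less.prems(4)] by blast
    then obtain b where b: "\<And>i. i \<in> ?J \<Longrightarrow> c i = cs (b i) (c k)"
      by metis
    have "(v k + (\<Sum>i\<in>?J. cs (b i) (v i))) * x * c k = 0" for x
    proof -
      have "(\<Sum>i\<in>?J. v i * x * c i) = (\<Sum>i\<in>?J. cs (b i) (v i)) * x * c k"
        unfolding sum_distrib_right by (rule sum.cong) (simp_all add: b)
      then show ?thesis
        using split [of x] by (simp add: distrib_right)
    qed
    then have "v k + (\<Sum>i\<in>?J. cs (b i) (v i)) = 0"
      using prime less.prems(4) by blast
    then have "v k = (\<Sum>i\<in>?J. cs (- b i) (v i))"
      by (simp add: sum_negf eq_neg_iff_add_eq_0)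
    then show ?thesis
      by (rule exI [where x = "\<lambda>i. - b i"])
  next
    case False
    then obtain j y where j: "j \<in> ?J" and y: "c k * y * c j - c j * y * c k \<noteq> 0"
      by auto
    have "(\<Sum>i\<in>?J. v i * x * (c k * y * c i - c i * y * c k)) = 0" for x
    proof -
      have "v k * (x * c k * y) * c k = (v k * x * c k) * y * c k"
        by (simp add: mult.assoc)
      then have "(\<Sum>i\<in>?J. v i * (x * c k * y) * c i) = (\<Sum>i\<in>?J. v i * x * c i) * y * c k"
        unfolding split by simp
      then show ?thesis
        by (simp add: sum_distrib_right right_diff_distrib sum_subtractf mult.assoc)
    qed
    then obtain \<beta> where \<beta>: "v j = (\<Sum>i\<in>?J - {j}. cs (\<beta> i) (v i))"
      using less.hyps [OF cJ fJ j, of "\<lambda>i. c k * y * c i - c i * y * c k"] y by blast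
    \<comment> \<open>The value 0 at \<open>k\<close> keeps the coefficient of \<open>v k\<close>
      equal to \<open>c k\<close>, hence nonzero, after \<open>v j\<close> is eliminated.\<close>
    define \<beta>' where "\<beta>' = \<beta>(k := 0)"
    have \<beta>': "v j = (\<Sum>i\<in>I - {j}. cs (\<beta>' i) (v i))"
    proof -
      have k: "k \<in> I - {j}" and *: "I - {j} - {k} = ?J - {j}"
        using j less.prems(2) by auto
      have "(\<Sum>i\<in>I - {j}. cs (\<beta>' i) (v i)) = (\<Sum>i\<in>?J - {j}. cs (\<beta>' i) (v i))"
        using sum.remove [OF _ k, of "\<lambda>i. cs (\<beta>' i) (v i)"] less.prems(1)
        by (simp add: \<beta>'_def *)
      also have "\<dots> = v j"
        unfolding \<beta> by (rule sum.cong) (auto simp: \<beta>'_def)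
      finally show ?thesis ..
    qed
    have jI: "j \<in> I"
      using j by simp
    have "(\<Sum>i\<in>I - {j}. v i * x * (c i + cs (\<beta>' i) (c j))) = 0" for x
    proof -
      have "(\<Sum>i\<in>I - {j}. v i * x * (c i + cs (\<beta>' i) (c j)))
          = (\<Sum>i\<in>I - {j}. v i * x * c i) + (\<Sum>i\<in>I - {j}. cs (\<beta>' i) (v i)) * x * c j"
        by (simp add: distrib_left sum.distrib sum_distrib_right)
      also have "\<dots> = (\<Sum>i\<in>I. v i * x * c i)"
        unfolding \<beta>' [symmetric] using sum.remove [OF less.prems(1) jI, of "\<lambda>i. v i * x * c i"]
        by simp
      finally show ?thesis
        using less.prems(3) by simp
    qed
    moreover have "finite (I - {j})" "card (I - {j}) < card I" "k \<in> I - {j}"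
      using less.prems(1,2) jI j by (auto simp del: card_Diff_insert intro: card_Diff1_less)
    moreover have "c k + cs (\<beta>' k) (c j) \<noteq> 0"
      using less.prems(4) by (simp add: \<beta>'_def)
    ultimately obtain \<gamma> where \<gamma>: "v k = (\<Sum>i\<in>I - {j} - {k}. cs (\<gamma> i) (v i))"
      using less.hyps [of "I - {j}" k "\<lambda>i. c i + cs (\<beta>' i) (c j)"] by blast
    define \<gamma>' where "\<gamma>' = \<gamma>(j := 0)"
    have *: "I - {j} - {k} = ?J - {j}"
      by auto
    have "(\<Sum>i\<in>?J. cs (\<gamma>' i) (v i)) = (\<Sum>i\<in>?J - {j}. cs (\<gamma>' i) (v i))"
      using sum.remove [OF fJ j, of "\<lambda>i. cs (\<gamma>' i) (v i)"] by (simp add: \<gamma>'_def)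
    also have "\<dots> = v k"
      unfolding \<gamma> * by (rule sum.cong) (auto simp: \<gamma>'_def)
    finally show ?thesis
      by metis
  qed
qed

lemma gpi_four_terms:
  assumes "\<And>x. a * x * a' + b * x * b' + c * x * c' + d * x * d' = 0" "a' \<noteq> 0"
  shows "\<exists>\<beta> \<gamma> \<delta>. a = cs \<beta> b + cs \<gamma> c + cs \<delta> d"
proof -
  have "\<exists>\<beta>. [a,b,c,d] ! 0 = (\<Sum>i\<in>{0,1,2,3} - {0::nat}. cs (\<beta> i) ([a,b,c,d] ! i))"
    by (rule generalized_polynomial_identity [where c = "\<lambda>i. [a',b',c',d'] ! i"])
      (use assms in \<open>simp_all add: add.assoc\<close>)
  then obtain \<beta> where "a = (\<Sum>i\<in>{1,2,3::nat}. cs (\<beta> i) ([a,b,c,d] ! i))"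
    by auto
  then have "a = cs (\<beta> 1) b + cs (\<beta> 2) c + cs (\<beta> 3) d"
    by (simp add: add.assoc)
  then show ?thesis
    by blast
qed

lemma gpi_three_terms:
  assumes "\<And>x. a * x * a' + b * x * b' + c * x * c' = 0" "a' \<noteq> 0"
  shows "\<exists>\<beta> \<gamma>. a = cs \<beta> b + cs \<gamma> c"
  using gpi_four_terms [of a a' b b' c c' 0 0] assms by auto

lemma gpi_two_terms:
  assumes "\<And>x. a * x * a' + b * x * b' = 0" "a' \<noteq> 0"
  shows "\<exists>\<beta>. a = cs \<beta> b"
  using gpi_three_terms [of a a' b b' 0 0] assms by auto

lemma central_imp_scalar:
  assumes "\<And>x. z * x = x * z"
  shows "\<exists>c. z = cs c 1"
  by (rule centrally_closed) (use assms in simp_all)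

section \<open>The Capelli expression as a test for linear dependence\<close>

lemma capelli_quadratic:
  assumes "u = cs \<alpha> t + cs \<beta> 1"
  shows "capelli t u x y z = 0"
  unfolding assms capelli_def by (simp add: algebra_simps)

text \<open>The expression involves \<open>t\<close> and \<open>u\<close> only through commutators,
  in which it is bilinear and alternating; scalars and the multiple of \<open>t\<close> added to
  \<open>u\<close> therefore drop out.\<close>

lemma capelli_affine:
  "capelli (cs k t + cs c 1) (cs l u + cs a t + cs b 1) x y z = cs (k * l) (capelli t u x y z)"
proof -
  have 1: "(cs k t + cs c 1) * x - x * (cs k t + cs c 1) = cs k (t * x - x * t)" for x
    by (simp add: algebra_simps)
  have 2: "(cs l u + cs a t + cs b 1) * x - x * (cs l u + cs a t + cs b 1)
      = cs l (u * x - x * u) + cs a (t * x - x * t)" for x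
    by (simp add: algebra_simps)
  have 3: "cs k p * y * (cs l q + cs a p') - (cs l q' + cs a p) * y * cs k p'
      = cs (k * l) (p * y * q - q' * y * p')" for p q p' q'
    by (simp add: scale_right_distrib scale_right_diff_distrib distrib_left distrib_right mult.commute)
  show ?thesis
    unfolding capelli_def 1 2 3 ..
qed

text \<open>For one \<open>x\<close> not commuting with \<open>t\<close>, the case
  \<open>z = x\<close> makes [u, x] a multiple \<alpha> of [t, x]. Primeness then transfers the same
  \<alpha> to all commutators, so u - \<alpha> t is central.\<close>

lemma capelli_eq_0_imp_quadratic:
  assumes t: "\<nexists>c. t = cs c 1"
    and *: "\<And>x y z. capelli t u x y z = 0"
  shows "\<exists>\<alpha> \<beta>. u = cs \<alpha> t + cs \<beta> 1"
proof -
  obtain x where x: "t * x - x * t \<noteq> 0"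
    using t central_imp_scalar [of t] by (metis eq_iff_diff_eq_0)
  have "(t * x - x * t) * y * (u * x - x * u) = (u * x - x * u) * y * (t * x - x * t)" for y
    using * [of x y x] by (simp add: capelli_def)
  then obtain \<alpha> where \<alpha>: "u * x - x * u = cs \<alpha> (t * x - x * t)"
    using centrally_closed [OF x] by blast
  have "(u - cs \<alpha> t) * z = z * (u - cs \<alpha> t)" for z
  proof -
    have "(t * x - x * t) * y * ((u * z - z * u) - cs \<alpha> (t * z - z * t)) = 0" for y
      using * [of x y z] unfolding capelli_def \<alpha> by (simp add: algebra_simps)
    then have "(u * z - z * u) - cs \<alpha> (t * z - z * t) = 0"
      using prime x by blast
    then show ?thesis
      by (simp add: algebra_simps)
  qed
  then obtain \<beta> where "u - cs \<alpha> t = cs \<beta> 1"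
    using central_imp_scalar by metis
  then show ?thesis
    by (metis add.commute diff_eq_eq)
qed

text \<open>The unit makes the functional identity easy to solve: \<open>B x 1 = x\<close> determines the unknown functions, and
  what remains is a generalized polynomial identity in one variable.\<close>
lemma commuting_trace:
  fixes B :: "'a \<Rightarrow> 'a \<Rightarrow> 'a" and t X Y Z :: 'a
  assumes B_add: "\<And>x y z. B (x + y) z = B x z + B y z"
    and B_cs: "\<And>c x y. B (cs c x) y = cs c (B x y)"
    and B_sym: "\<And>x y. B x y = B y x"
    and B_1: "\<And>x. B x 1 = x"
    and B_comm: "\<And>x. B x x * x = x * B x x"
    and t: "capelli t (t * t) X Y Z \<noteq> 0"
  shows "\<exists>\<kappa> \<mu>. (\<forall>x y. \<mu> (x + y) = \<mu> x + \<mu> y) \<and> (\<forall>c x. \<mu> (cs c x) = c * \<mu> x) \<and>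
           (\<forall>x. \<exists>\<nu>. B x x = cs \<kappa> (x * x) + cs (\<mu> x) x + cs \<nu> 1)"
proof -
  have B_add': "B x (y + z) = B x y + B x z" for x y z
    by (metis B_add B_sym)
  have B_cs': "B x (cs c y) = cs c (B x y)" for x y c
    by (metis B_cs B_sym)
  \<comment> \<open>The full linearization of [B x x, x] = 0; by symmetry of \<open>B\<close> every
    term occurs twice.\<close>
  define H where "H x y z = B x y * z + B y z * x + B x z * y
    - z * B x y - x * B y z - y * B x z" for x y z
  have H: "H x y z = 0" for x y z
  proof (rule double_eq_0)
    define T where "T x = B x x * x - x * B x x" for x
    have "T (x + y + z) - T (x + y) - T (y + z) - T (x + z) + T x + T y + T z = H x y z + H x y z"
      unfolding T_def H_def
      by (simp add: B_add B_add' B_sym [of y x] B_sym [of z x] B_sym [of z y] algebra_simps)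
    then show "H x y z + H x y z = 0"
      by (simp add: T_def B_comm)
  qed
  \<comment> \<open>\<open>D\<close> measures how far \<open>B x\<close> is from commuting with
    right multiplication by \<open>t\<close>; \<open>C\<close> is the corresponding second
    difference in both arguments of \<open>B\<close>.\<close>
  define D where "D y x = B x (y * t) - B x y * t" for y x
  define G where "G y x = t * D y x - D y x * t" for y x
  define C where "C y z = B (y * t) (z * t) - B (y * t) z * t - B y (z * t) * t + B y z * t * t" for y z
  \<comment> \<open>This combination of instances of \<open>H\<close> cancels all terms ending in \<open>y\<close> or \<open>z\<close>.\<close>
  have L: "B (y * t) (z * t) * x - (B (y * t) z + B y (z * t)) * x * t + B y z * x * t * t
      = z * G y x + x * C y z + y * G z x" for x y z
  proof -
    have "H x (y * t) (z * t) - H x (y * t) z * t - H x y (z * t) * t + H x y z * t * t = 0"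
      by (simp add: H)
    then show ?thesis
      unfolding H_def G_def C_def D_def by (simp add: algebra_simps)
  qed
  define p where "p = t * X - X * t"
  define s where "s = t * Z - Z * t"
  \<comment> \<open>\<open>ev f = \<Sum> f a\<^sub>i * b\<^sub>i\<close>, where \<open>\<Sum> a\<^sub>i u b\<^sub>i = capelli t u X Y Z\<close>\<close>
  define ev where "ev f = f (p * Y) * Z - f (p * Y * Z) - f 1 * X * Y * s + f X * Y * s"
    for f :: "'a \<Rightarrow> 'a"
  \<comment> \<open>Right multiplication by 1 and by \<open>t\<close> gives \<open>ev\<close> value
    0, while right multiplication by \<open>t * t\<close> gives the nonzero Capelli value. Thus
    \<open>ev\<close> keeps just the last term on the left of \<open>L\<close>.\<close>
  define w where "w = ev (\<lambda>a. a * t * t)"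
  have w: "w \<noteq> 0"
    using t by (simp add: w_def ev_def capelli_def p_def s_def algebra_simps)
  have ev_add: "ev (\<lambda>a. f a + g a) = ev f + ev g" for f g
    by (simp add: ev_def algebra_simps)
  have ev_mult: "ev (\<lambda>a. x * f a) = x * ev f" for f x
    by (simp add: ev_def algebra_simps)
  have ev_cs: "ev (\<lambda>a. cs c (f a)) = cs c (ev f)" for f c
    by (simp add: ev_def algebra_simps)
  define S where "S y x = ev (\<lambda>a. G y (x * a))" for y x
  define R where "R y z = ev (\<lambda>a. a * C y z)" for y z
  have SR: "B y z * x * w = z * S y x + x * R y z + y * S z x" for x y z
  proof -
    have "ev (\<lambda>a. B (y * t) (z * t) * (x * a) - (B (y * t) z + B y (z * t)) * (x * a) * t + B y z * (x * a) * t * t)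
        = ev (\<lambda>a. z * G y (x * a) + x * a * C y z + y * G z (x * a))"
      by (simp add: L)
    also have "\<dots> = z * S y x + x * R y z + y * S z x"
      by (simp add: ev_add ev_mult S_def R_def mult.assoc)
    also have "ev (\<lambda>a. B (y * t) (z * t) * (x * a) - (B (y * t) z + B y (z * t)) * (x * a) * t + B y z * (x * a) * t * t)
        = B y z * x * w"
    proof -
      have "ev (\<lambda>a. a) = 0" "ev (\<lambda>a. a * t) = 0"
        by (simp_all add: ev_def p_def s_def algebra_simps)
      moreover have "ev (\<lambda>a. b1 * (x * a) - b2 * (x * a) * t + b3 * (x * a) * t * t)
          = b1 * x * ev (\<lambda>a. a) - b2 * x * ev (\<lambda>a. a * t) + b3 * x * w" for b1 b2 b3
        by (simp add: w_def ev_def algebra_simps)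
      ultimately show ?thesis
        by simp
    qed
    finally show ?thesis .
  qed
  \<comment> \<open>Solving \<open>SR\<close> by means of the unit: y = z = 1 yields
    \<open>S 1 x = x * r\<close>, and then z = 1 expresses \<open>S y x\<close> through
    \<open>r'\<close> and \<open>\<rho> y\<close>.\<close>
  define r where "r = cs (1/2) (w - R 1 1)"
  define r' where "r' = w - r"
  define \<rho> where "\<rho> y = R y 1" for y
  have S1: "S 1 x = x * r" for x
  proof -
    have "x * w - x * R 1 1 = S 1 x + S 1 x"
      using SR [of 1 1 x] B_1 [of 1] by (simp add: algebra_simps)
    then have "cs (1/2) (S 1 x + S 1 x) = x * r"
      by (simp add: r_def right_diff_distrib)
    then show ?thesis
      using scale_left_distrib [of "1/2" "1/2" "S 1 x"] by (simp add: scale_right_distrib)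
  qed
  have S: "S y x = y * x * r' - x * \<rho> y" for y x
    using SR [of y 1 x] by (simp add: B_1 S1 r'_def \<rho>_def algebra_simps)
  have main: "B y y * x * w - (y * y + y * y) * x * r' + (y + y) * x * \<rho> y - x * R y y = 0" for x y
    using SR [of y y x] unfolding S by (simp add: algebra_simps)
  have \<rho>_add: "\<rho> (x + y) = \<rho> x + \<rho> y" for x y
    unfolding \<rho>_def R_def ev_add [symmetric] C_def
    by (rule arg_cong [of _ _ ev]) (simp add: B_add algebra_simps)
  have \<rho>_cs: "\<rho> (cs c x) = cs c (\<rho> x)" for x c
    unfolding \<rho>_def R_def ev_cs [symmetric] C_def
    by (rule arg_cong [of _ _ ev]) (simp add: B_cs algebra_simps)
  have tq: "\<nexists>\<alpha> \<beta>. t * t = cs \<alpha> t + cs \<beta> 1"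
    using t capelli_quadratic by blast
  \<comment> \<open>At \<open>t\<close> the elements 1, \<open>t\<close>, \<open>t * t\<close> are
    independent, so the coefficient of \<open>t * t\<close> must vanish once \<open>B t t\<close> is
    eliminated.\<close>
  obtain \<kappa> where \<kappa>: "r' = cs (\<kappa>/2) w"
  proof -
    have "B t t * x * w + (t * t + t * t) * x * (- r') + (t + t) * x * \<rho> t + 1 * x * (- R t t) = 0" for x
      using main [of t x] by simp
    from gpi_four_terms [OF this w] obtain \<beta>1 \<beta>2 \<beta>3 where
      \<beta>: "B t t = cs \<beta>1 (t * t + t * t) + cs \<beta>2 (t + t) + cs \<beta>3 1"
      by blast
    have *: "(t * t) * x * (cs (\<beta>1 + \<beta>1) w - (r' + r')) + t * x * (cs (\<beta>2 + \<beta>2) w + (\<rho> t + \<rho> t))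
       + 1 * x * (cs \<beta>3 w - R t t) = 0" for x
      using main [of t x] unfolding \<beta> scale_left_distrib by (simp add: algebra_simps)
    have "cs (\<beta>1 + \<beta>1) w - (r' + r') = 0"
      using gpi_three_terms [OF *] tq by blast
    then have "cs (1/2) (r' + r') = cs (1/2) (cs (\<beta>1 + \<beta>1) w)"
      by simp
    then have "r' = cs ((\<beta>1 + \<beta>1) / 2) w"
      using scale_left_distrib [of "1/2" "1/2" r'] by (simp add: scale_right_distrib)
    then show ?thesis
      by (rule that)
  qed
  have main': "(B y y - cs \<kappa> (y * y)) * x * w + y * x * (\<rho> y + \<rho> y) + 1 * x * (- R y y) = 0" for x y
  proof -
    have "cs \<kappa> (y * y * x * w) = cs (\<kappa>/2) (y * y * x * w) + cs (\<kappa>/2) (y * y * x * w)"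
      using scale_left_distrib [of "\<kappa>/2" "\<kappa>/2"] by simp
    then show ?thesis
      using main [of y x] unfolding \<kappa> by (simp add: algebra_simps)
  qed
  \<comment> \<open>Tying \<open>m\<close> to \<open>\<rho> y\<close>, which is linear in
    \<open>y\<close>, is what makes \<mu> linear: for scalar \<open>y\<close> the equation for
    \<open>B y y\<close> alone would allow any \<open>m\<close>.\<close>
  have ex: "\<exists>m n. \<rho> y = cs (- m / 2) w \<and> B y y = cs \<kappa> (y * y) + cs m y + cs n 1" for y
  proof (cases "\<exists>c. y = cs c 1")
    case True
    then obtain c where c: "y = cs c 1"
      by blast
    have R: "R 1 1 = cs (\<kappa> - 1) w"
    proof -
      have "r = w - cs (\<kappa>/2) w"
        using \<kappa> by (simp add: r'_def algebra_simps)
      then have "cs 2 r = cs 2 (w - cs (\<kappa>/2) w)"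
        by simp
      then have "w - R 1 1 = cs 2 w - cs \<kappa> w"
        by (simp add: r_def scale_right_diff_distrib)
      then show ?thesis
        using scale_left_distrib [of 1 1 w] by (simp add: scale_left_diff_distrib algebra_simps)
    qed
    have "\<rho> y = cs (- (- 2 * c * (\<kappa> - 1)) / 2) w"
      unfolding c \<rho>_cs by (simp add: \<rho>_def R)
    moreover have "B y y = cs \<kappa> (y * y) + cs m y + cs (c * c - \<kappa> * c * c - m * c) 1" for m
      unfolding c by (simp add: B_cs B_cs' B_1 scale_left_distrib scale_left_diff_distrib mult.assoc)
    ultimately show ?thesis
      by blast
  next
    case False
    obtain m n where mn: "B y y - cs \<kappa> (y * y) = cs m y + cs n 1"
      using gpi_three_terms [OF main' w] by blast
    have "y * x * (cs m w + (\<rho> y + \<rho> y)) + 1 * x * (cs n w - R y y) = 0" for x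
      using main' [of y x] unfolding mn by (simp add: algebra_simps)
    then have "cs m w + (\<rho> y + \<rho> y) = 0"
      using gpi_two_terms [of y _ 1] False by blast
    then have "cs (1/2) (\<rho> y + \<rho> y) = cs (1/2) (- cs m w)"
      by (simp add: add_eq_0_iff)
    then have "\<rho> y = cs (- m / 2) w"
      using scale_left_distrib [of "1/2" "1/2" "\<rho> y"] by (simp add: scale_right_distrib)
    moreover have "B y y = cs \<kappa> (y * y) + cs m y + cs n 1"
      using mn by (simp add: algebra_simps)
    ultimately show ?thesis
      by blast
  qed
  then obtain \<mu> where \<mu>: "\<And>y. \<rho> y = cs (- \<mu> y / 2) w"
      "\<And>y. \<exists>n. B y y = cs \<kappa> (y * y) + cs (\<mu> y) y + cs n 1"
    by metis
  have "\<mu> (x + y) = \<mu> x + \<mu> y" for x y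
  proof -
    have "cs (- \<mu> (x + y) / 2) w = cs (- \<mu> x / 2 + - \<mu> y / 2) w"
      using \<rho>_add [of x y] by (simp only: \<mu>(1) scale_left_distrib)
    then show ?thesis
      using w by (simp only: scale_cancel_right) (simp add: field_simps)
  qed
  moreover have "\<mu> (cs c x) = c * \<mu> x" for c x
  proof -
    have "cs (- \<mu> (cs c x) / 2) w = cs (c * (- \<mu> x / 2)) w"
      using \<rho>_cs [of c x] by (simp only: \<mu>(1) scale_scale)
    then show ?thesis
      using w by (simp only: scale_cancel_right) (simp add: field_simps)
  qed
  ultimately show ?thesis
    using \<mu>(2) by blast
qed

section \<open>Jordan homomorphisms\<close>

text \<open>Exchanging \<open>u\<close> and \<open>v\<close> at \<open>x * u * y\<close>, at
  \<open>x\<close> and at \<open>y\<close> turns \<open>u * x * u * y * v\<close> into its negative,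
  so it is 0 and primeness applies twice.\<close>

lemma antisymmetric_product_eq_0:
  fixes u v :: 'a
  assumes *: "\<And>x. u * x * v + v * x * u = 0"
  shows "u = 0 \<or> v = 0"
proof -
  have uv: "u * x * v = - (v * x * u)" for x
    using * [of x] by (simp add: eq_neg_iff_add_eq_0)
  have "(u * x * u) * y * v = 0" for x y
  proof (rule double_eq_0)
    have "u * x * u * y * v = u * x * v * y * u"
      using uv [of "x * u * y"] arg_cong [OF uv [of x], of "\<lambda>a. a * y * u"] by (simp add: mult.assoc)
    also have "\<dots> = - (u * x * u * y * v)"
      using arg_cong [OF uv [of y], of "\<lambda>a. u * x * a"] by (simp add: mult.assoc)
    finally show "u * x * u * y * v + u * x * u * y * v = 0"
      by (simp add: eq_neg_iff_add_eq_0)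
  qed
  then have "v = 0 \<or> u * x * u = 0" for x
    using prime [of "u * x * u" v] by blast
  then show ?thesis
    using prime [of u u] by blast
qed

text \<open>A group is not the union of two proper subgroups, here the kernels of \<open>f\<close>
  and \<open>g\<close>.\<close>

lemma additive_union_zero:
  fixes f g :: "'b::ab_group_add \<Rightarrow> 'a"
  assumes f: "\<And>x y. f (x + y) = f x + f y" and g: "\<And>x y. g (x + y) = g x + g y"
    and fg: "\<And>x. f x = 0 \<or> g x = 0"
  shows "(\<forall>x. f x = 0) \<or> (\<forall>x. g x = 0)"
proof (rule ccontr)
  assume "\<not> ?thesis"
  then obtain x y where "f x \<noteq> 0" "g y \<noteq> 0"
    by blast
  moreover from this have "g x = 0" "f y = 0"
    using fg by blast+
  ultimately show False
    using fg [of "x + y"] by (simp add: f g)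
qed

text \<open>Let \<open>f\<close> and \<open>g\<close> be the defects of multiplicativity and
  antimultiplicativity. Grouping the words in xy r yx + yx r xy in two ways gives f s g + g s f = 0
  for all s, so one defect vanishes at each pair; the subgroup argument, once in each variable,
  makes the choice uniform.\<close>

theorem jordan_hom_onto_prime:
  fixes \<theta> :: "'b::ring \<Rightarrow> 'a"
  assumes add: "\<And>x y. \<theta> (x + y) = \<theta> x + \<theta> y"
    and sq: "\<And>x. \<theta> (x * x) = \<theta> x * \<theta> x"
    and surj: "surj \<theta>"
  shows "(\<forall>x y. \<theta> (x * y) = \<theta> x * \<theta> y) \<or> (\<forall>x y. \<theta> (x * y) = \<theta> y * \<theta> x)"
proof -
  have 0: "\<theta> 0 = 0"
    using add [of 0 0] by simp
  have minus: "\<theta> (- x) = - \<theta> x" for x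
    using add [of x "- x"] 0 by (simp add: eq_neg_iff_add_eq_0 add.commute)
  have diff: "\<theta> (x - y) = \<theta> x - \<theta> y" for x y
    using add [of x "- y"] minus by simp
  have halve: "u = v" if "u + u = v + v" for u v :: 'a
    using double_eq_0 [of "u - v"] that by (simp add: algebra_simps)
  have sym: "\<theta> (x * y) + \<theta> (y * x) = \<theta> x * \<theta> y + \<theta> y * \<theta> x" for x y
    using sq [of "x + y"] by (simp add: add sq algebra_simps)
  have triple: "\<theta> (x * y * x) = \<theta> x * \<theta> y * \<theta> x" for x y
  proof (rule halve)
    have "x * y * x + x * y * x
        = (x * (x * y + y * x) + (x * y + y * x) * x) - (x * x * y + y * (x * x))"
      by (simp add: algebra_simps)
    then have "\<theta> (x * y * x) + \<theta> (x * y * x)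
        = (\<theta> (x * (x * y + y * x)) + \<theta> ((x * y + y * x) * x)) - (\<theta> (x * x * y) + \<theta> (y * (x * x)))"
      by (metis add diff)
    also have "\<dots> = \<theta> x * \<theta> y * \<theta> x + \<theta> x * \<theta> y * \<theta> x"
      unfolding sym by (simp add: add sym sq algebra_simps)
    finally show "\<theta> (x * y * x) + \<theta> (x * y * x) = \<theta> x * \<theta> y * \<theta> x + \<theta> x * \<theta> y * \<theta> x" .
  qed
  have triple': "\<theta> (x * y * z) + \<theta> (z * y * x) = \<theta> x * \<theta> y * \<theta> z + \<theta> z * \<theta> y * \<theta> x" for x y z
    using triple [of "x + z" y] triple [of x y] triple [of z y] by (simp add: add algebra_simps)
  define f where "f x y = \<theta> (x * y) - \<theta> x * \<theta> y" for x y
  define g where "g x y = \<theta> (x * y) - \<theta> y * \<theta> x" for x y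
  have fg: "f x y = 0 \<or> g x y = 0" for x y
  proof (rule antisymmetric_product_eq_0)
    fix s
    obtain r where r: "s = \<theta> r"
      using surj by auto
    define p q where "p = \<theta> x * \<theta> y" and "q = \<theta> y * \<theta> x"
    have W: "\<theta> (x * y) = p + f x y" "\<theta> (y * x) = q - f x y" "g x y = p - q + f x y"
      using sym [of x y] by (simp_all add: f_def g_def p_def q_def algebra_simps)
    have "\<theta> (x * y * r * (y * x)) + \<theta> (y * x * r * (x * y))
        = \<theta> (x * (y * r * y) * x) + \<theta> (y * (x * r * x) * y)"
      by (simp add: mult.assoc)
    also have "\<dots> = p * s * q + q * s * p"
      by (simp only: triple r p_def q_def) (simp add: mult.assoc)
    finally have "(p + f x y) * s * (q - f x y) + (q - f x y) * s * (p + f x y) = p * s * q + q * s * p"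
      unfolding triple' r [symmetric] W .
    then show "f x y * s * g x y + g x y * s * f x y = 0"
      unfolding W by (simp add: algebra_simps)
  qed
  have f_add: "f (x + y) z = f x z + f y z" "f z (x + y) = f z x + f z y"
    and g_add: "g (x + y) z = g x z + g y z" "g z (x + y) = g z x + g z y" for x y z
    by (simp_all add: f_def g_def add algebra_simps)
  have each: "(\<forall>y. f x y = 0) \<or> (\<forall>y. g x y = 0)" for x
    by (rule additive_union_zero) (simp_all add: f_add g_add fg)
  have "(\<forall>x y. f x y = 0) \<or> (\<forall>x y. g x y = 0)"
  proof (rule ccontr)
    assume "\<not> ?thesis"
    then obtain x y x' y' where "f x y \<noteq> 0" "g x' y' \<noteq> 0"
      by blast
    moreover from this have "\<forall>z. g x z = 0" "\<forall>z. f x' z = 0"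
      using each by blast+
    ultimately show False
      using each [of "x + x'"] by (auto simp: f_add g_add)
  qed
  then show ?thesis
    by (simp add: f_def g_def)
qed

end

section \<open>Commutativity preservers\<close>

locale normed_centrally_closed_prime = centrally_closed_prime cs
  for cs :: "complex \<Rightarrow> 'a::real_normed_algebra_1 \<Rightarrow> 'a" +
  assumes cs_of_real: "cs (complex_of_real r) x = r *\<^sub>R x"
begin

text \<open>Computing \<open>\<theta> (x\<^sup>4)\<close> in two ways shows that \<open>\<theta> x\<close> is quadratic wherever the defect \<open>e x\<close> is nonzero.
  As \<open>e\<close> is a quadratic form, it would be nonzero at points arbitrarily close to \<open>t\<close>.\<close>
lemma jordan_modulo_scalars:
  fixes \<theta> :: "'a \<Rightarrow> 'a"
  assumes add: "\<And>x y. \<theta> (x + y) = \<theta> x + \<theta> y"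
    and cs: "\<And>c x. \<theta> (cs c x) = cs c (\<theta> x)"
    and e: "\<And>x. \<theta> (x * x) = \<theta> x * \<theta> x + cs (e x) 1"
    and t: "capelli (\<theta> t) (\<theta> t * \<theta> t) X Y Z \<noteq> 0"
  shows "\<theta> (x * x) = \<theta> x * \<theta> x"
proof -
  have cs_half: "cs (1/2) x + cs (1/2) x = x" for x :: 'a
    using scale_left_distrib [of "1/2" "1/2" x] by simp
  have scalar_sym: "\<theta> (x * y) + \<theta> (y * x) = \<theta> x * \<theta> y + \<theta> y * \<theta> x + cs (e (x + y) - e x - e y) 1" for x y
  proof -
    have "\<theta> (x * x) + \<theta> (x * y) + \<theta> (y * x) + \<theta> (y * y)
        = \<theta> x * \<theta> x + \<theta> x * \<theta> y + \<theta> y * \<theta> x + \<theta> y * \<theta> y + cs (e (x + y)) 1"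
      using e [of "x + y"] by (simp add: add algebra_simps)
    then show ?thesis
      unfolding e by (simp add: algebra_simps)
  qed
  have quadratic: "capelli (\<theta> a) (\<theta> a * \<theta> a) X Y Z = 0" if "e a \<noteq> 0" for a
  proof -
    define T where "T = \<theta> a"
    have sq: "\<theta> (a * a) = T * T + cs (e a) 1"
      by (simp add: e T_def)
    obtain k where k: "\<theta> (a * a * a) = T * T * T + cs (e a) T + cs k 1"
    proof -
      define k where "k = e (a * a + a) - e (a * a) - e a"
      have "\<theta> (a * a * a) + \<theta> (a * a * a)
          = (T * T * T + cs (e a) T) + (T * T * T + cs (e a) T) + cs k 1"
        using scalar_sym [of "a * a" a, folded k_def] by (simp add: sq T_def [symmetric] algebra_simps)
      then have "\<theta> (a * a * a) = T * T * T + cs (e a) T + cs (k/2) 1"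
        using double_eq_0 [of "\<theta> (a * a * a) - (T * T * T + cs (e a) T + cs (k/2) 1)"]
        using cs_half [of "cs k 1"]
        by (simp add: algebra_simps)
      then show ?thesis
        by (rule that)
    qed
    have 4: "\<theta> (a * a * a * a) = T * T * T * T + cs (e a) (T * T) + cs (e a) (T * T)
        + cs (e a * e a + e (a * a)) 1"
      using e [of "a * a"] by (simp add: sq mult.assoc algebra_simps)
    define k' where "k' = e (a * a * a + a) - e (a * a * a) - e a"
    have "\<theta> (a * a * a * a) + \<theta> (a * a * a * a)
        = (T * T * T * T + cs (e a) (T * T) + cs k T) + (T * T * T * T + cs (e a) (T * T) + cs k T) + cs k' 1"
      using scalar_sym [of "a * a * a" a, folded k'_def] k by (simp add: T_def [symmetric] algebra_simps)
    then have "(cs (e a) (T * T) - cs k T) + (cs (e a) (T * T) - cs k T)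
        = cs (k' - 2 * (e a * e a + e (a * a))) 1"
      unfolding 4 mult_2 scale_left_diff_distrib scale_left_distrib by (simp add: algebra_simps)
    then have "cs (1/2) ((cs (e a) (T * T) - cs k T) + (cs (e a) (T * T) - cs k T))
        = cs ((k' - 2 * (e a * e a + e (a * a))) / 2) 1"
      by simp
    then have "cs (e a) (T * T) - cs k T = cs ((k' - 2 * (e a * e a + e (a * a))) / 2) 1"
      unfolding scale_right_distrib cs_half .
    then obtain k'' where "cs (e a) (T * T) = cs k T + cs k'' 1"
      by (metis diff_eq_eq add.commute)
    then have "cs (1 / e a) (cs (e a) (T * T)) = cs (1 / e a) (cs k T + cs k'' 1)"
      by simp
    then have "T * T = cs (k / e a) T + cs (k'' / e a) 1"
      using that by (simp add: scale_right_distrib)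
    then show ?thesis
      unfolding T_def by (rule capelli_quadratic)
  qed
  have "e b = 0" for b
  proof (rule ccontr)
    assume b: "e b \<noteq> 0"
    have et: "e t = 0"
      using quadratic t by blast
    \<comment> \<open>On the line t + s b the quadratic form \<open>e\<close> is a polynomial in s
      without constant term and with leading coefficient \<open>e b\<close>, so it has at most one
      nonzero real root.\<close>
    define m where "m = e (t + b) - e b"
    define a where "a s = t + cs (complex_of_real s) b" for s
    have ea: "e (a s) = complex_of_real s * (m + complex_of_real s * e b)" for s
    proof -
      let ?s = "complex_of_real s"
      have "cs (e (a s)) 1 = \<theta> (a s * a s) - \<theta> (a s) * \<theta> (a s)"
        using e [of "a s"] by simp
      also have "\<dots> = (\<theta> (t * t) - \<theta> t * \<theta> t) + cs ?s (\<theta> (t * b) + \<theta> (b * t) - (\<theta> t * \<theta> b + \<theta> b * \<theta> t))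
          + cs (?s * ?s) (\<theta> (b * b) - \<theta> b * \<theta> b)"
        unfolding a_def by (simp add: add cs algebra_simps)
      also have "\<dots> = cs (?s * (m + ?s * e b)) 1"
        unfolding scalar_sym e [of t] e [of b] by (simp add: m_def et algebra_simps)
      finally show ?thesis
        by (simp only: scale_cancel_right) simp
    qed
    have "eventually (\<lambda>s::real. s \<noteq> 0 \<and> s \<noteq> Re (- m / e b)) (at 0)"
      by (intro eventually_conj eventually_neq_at_within)
    then have "eventually (\<lambda>s. capelli (\<theta> (a s)) (\<theta> (a s) * \<theta> (a s)) X Y Z = 0) (at 0)"
    proof eventually_elim
      case (elim s)
      have "m + complex_of_real s * e b \<noteq> 0"
      proof
        assume "m + complex_of_real s * e b = 0"
        then have "complex_of_real s = - m / e b"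
          using b by (simp add: field_simps eq_neg_iff_add_eq_0)
        then have "s = Re (- m / e b)"
          by (metis Re_complex_of_real)
        then show False
          using elim by blast
      qed
      then have "e (a s) \<noteq> 0"
        using elim by (simp add: ea)
      then show ?case
        by (rule quadratic)
    qed
    then have "((\<lambda>s. capelli (\<theta> (a s)) (\<theta> (a s) * \<theta> (a s)) X Y Z) \<longlongrightarrow> 0) (at 0)"
      by (rule tendsto_eventually)
    moreover have lim: "((\<lambda>s. \<theta> (a s)) \<longlongrightarrow> \<theta> t) (at 0)"
    proof -
      have "((\<lambda>s. \<theta> t + s *\<^sub>R \<theta> b) \<longlongrightarrow> \<theta> t + 0 *\<^sub>R \<theta> b) (at 0)"
        by (intro tendsto_intros)
      then show ?thesis
        by (simp add: a_def add cs cs_of_real [symmetric])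
    qed
    have "((\<lambda>s. capelli (\<theta> (a s)) (\<theta> (a s) * \<theta> (a s)) X Y Z)
        \<longlongrightarrow> capelli (\<theta> t) (\<theta> t * \<theta> t) X Y Z) (at 0)"
      unfolding capelli_def by (intro tendsto_intros lim)
    ultimately show False
      using t tendsto_unique [OF at_neq_bot] by blast
  qed
  then show ?thesis
    by (simp add: e)
qed

theorem commutativity_preserver:
  fixes \<phi> :: "'a \<Rightarrow> 'a" and t X Y Z :: 'a
  assumes bij: "bij \<phi>"
    and add: "\<And>x y. \<phi> (x + y) = \<phi> x + \<phi> y"
    and cs: "\<And>c x. \<phi> (cs c x) = cs c (\<phi> x)"
    and one: "\<phi> 1 = 1"
    and comm: "\<And>x. \<phi> (x * x) * \<phi> x = \<phi> x * \<phi> (x * x)"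
    and t: "capelli t (t * t) X Y Z \<noteq> 0"
  shows "\<exists>\<alpha> \<theta> \<omega>. (automorphism cs \<theta> \<or> antiautomorphism cs \<theta>) \<and>
           clinear_map cs (*) \<omega> \<and> (\<forall>a. \<phi> a = cs \<alpha> (\<theta> a) + cs (\<omega> a) 1)"
proof -
  define \<psi> where "\<psi> = inv \<phi>"
  have \<phi>\<psi>: "\<phi> (\<psi> x) = x" for x
    unfolding \<psi>_def using bij by (simp add: bij_is_surj surj_f_inv_f)
  have \<psi>\<phi>: "\<psi> (\<phi> x) = x" for x
    unfolding \<psi>_def using bij by (simp add: bij_is_inj inv_f_f)
  have inj: "\<phi> x = \<phi> y \<longleftrightarrow> x = y" for x y
    by (metis \<psi>\<phi>)
  have \<psi>_add: "\<psi> (x + y) = \<psi> x + \<psi> y" and \<psi>_cs: "\<psi> (cs c x) = cs c (\<psi> x)" and \<psi>_1: "\<psi> 1 = 1" for c x y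
    by (metis \<phi>\<psi> \<psi>\<phi> add, metis \<phi>\<psi> \<psi>\<phi> cs, metis \<psi>\<phi> one)
  have cs_half: "cs (1/2) x + cs (1/2) x = x" for x :: 'a
    using scale_left_distrib [of "1/2" "1/2" x] by simp
  define B where "B x y = cs (1/2) (\<phi> (\<psi> x * \<psi> y + \<psi> y * \<psi> x))" for x y
  have Bxx: "B x x = \<phi> (\<psi> x * \<psi> x)" for x
    by (simp add: B_def add scale_right_distrib cs_half)
  have B_add: "B (x + y) z = B x z + B y z" for x y z
    by (simp add: B_def \<psi>_add add algebra_simps)
  have B_cs: "B (cs c x) y = cs c (B x y)" for c x y
    by (simp add: B_def \<psi>_cs add cs scale_right_distrib mult.commute)
  have B_sym: "B x y = B y x" for x y
    by (simp add: B_def add.commute)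
  have B_1: "B x 1 = x" for x
    by (simp add: B_def add scale_right_distrib cs_half \<psi>_1 \<phi>\<psi>)
  have B_comm: "B x x * x = x * B x x" for x
    using comm [of "\<psi> x"] by (simp add: Bxx \<phi>\<psi>)
  obtain \<kappa> \<mu> where \<mu>_add: "\<And>x y. \<mu> (x + y) = \<mu> x + \<mu> y"
    and \<mu>_cs: "\<And>c x. \<mu> (cs c x) = c * \<mu> x"
    and B: "\<And>x. \<exists>\<nu>. B x x = cs \<kappa> (x * x) + cs (\<mu> x) x + cs \<nu> 1"
    using commuting_trace [of B, OF B_add B_cs B_sym B_1 B_comm t] by blast
  define m where "m a = \<mu> (\<phi> a)" for a
  have "\<exists>\<nu>. \<phi> (a * a) = cs \<kappa> (\<phi> a * \<phi> a) + cs (m a) (\<phi> a) + cs \<nu> 1" for a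
    using B [of "\<phi> a"] by (simp add: Bxx \<psi>\<phi> m_def)
  then obtain \<nu> where \<phi>_sq: "\<And>a. \<phi> (a * a) = cs \<kappa> (\<phi> a * \<phi> a) + cs (m a) (\<phi> a) + cs (\<nu> a) 1"
    by metis
  have m_add: "m (a + b) = m a + m b" and m_cs: "m (cs c a) = c * m a" for a b c
    by (simp_all add: m_def add cs \<mu>_add \<mu>_cs)
  have \<kappa>: "\<kappa> \<noteq> 0"
  proof
    assume "\<kappa> = 0"
    then have "\<phi> (t * t) = \<phi> (cs (m t) t + cs (\<nu> t) 1)"
      using \<phi>_sq [of t] by (simp add: add cs one)
    then have "t * t = cs (m t) t + cs (\<nu> t) 1"
      by (simp only: inj)
    then show False
      using t capelli_quadratic by blast
  qed
  \<comment> \<open>Completing the square absorbs the linear term \<open>m a\<close>; only a scalar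
    error is left.\<close>
  define \<theta> where "\<theta> a = cs \<kappa> (\<phi> a) + cs (m a / 2) 1" for a
  have \<theta>_add: "\<theta> (x + y) = \<theta> x + \<theta> y" for x y
    by (simp add: \<theta>_def add m_add add_divide_distrib algebra_simps)
  have \<theta>_cs: "\<theta> (cs c x) = cs c (\<theta> x)" for c x
    by (simp add: \<theta>_def cs m_cs scale_right_distrib mult.commute)
  obtain t' where t': "\<phi> t' = t"
    using \<phi>\<psi> by blast
  have \<theta>_t: "capelli (\<theta> t') (\<theta> t' * \<theta> t') X Y Z \<noteq> 0"
  proof -
    have "capelli (\<theta> t') (\<theta> t' * \<theta> t') X Y Z = cs (\<kappa> * \<kappa> * \<kappa>) (capelli t (t * t) X Y Z)"
    proof -
      have "\<theta> t' * \<theta> t' = cs (\<kappa> * \<kappa>) (t * t) + cs (\<kappa> * m t') t + cs (m t' / 2 * (m t' / 2)) 1"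
        using cs_half [of "cs (\<kappa> * m t') t"]
        by (simp add: \<theta>_def t' distrib_left distrib_right scale_right_distrib mult.commute add.assoc)
      then show ?thesis
        unfolding \<theta>_def t' by (simp only: capelli_affine mult.assoc)
    qed
    then show ?thesis
      using t \<kappa> by simp
  qed
  have \<theta>_e: "\<theta> (x * x) = \<theta> x * \<theta> x + cs (\<kappa> * \<nu> x + m (x * x) / 2 - m x / 2 * (m x / 2)) 1" for x
  proof -
    have "cs (\<kappa> * m x) (\<phi> x) = cs (\<kappa> * (m x / 2)) (\<phi> x) + cs (\<kappa> * (m x / 2)) (\<phi> x)"
      unfolding scale_left_distrib [symmetric] by simp
    then show ?thesis
      unfolding \<theta>_def \<phi>_sq by (simp add: algebra_simps)
  qed
  have \<theta>_sq: "\<theta> (x * x) = \<theta> x * \<theta> x" for x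
    by (rule jordan_modulo_scalars [of \<theta> "\<lambda>x. \<kappa> * \<nu> x + m (x * x) / 2 - m x / 2 * (m x / 2)",
          OF \<theta>_add \<theta>_cs \<theta>_e \<theta>_t])
  have \<phi>_\<theta>: "\<phi> a = cs (1 / \<kappa>) (\<theta> a) + cs (- m a / (2 * \<kappa>)) 1" for a
    using \<kappa> by (simp add: \<theta>_def scale_right_distrib)
  \<comment> \<open>As \<theta> and \<kappa> \<phi> differ by scalars, bijectivity of \<theta>
    hinges on its value at 1. This is an idempotent scalar; if it were 0, squaring x + 1 would give
    \<theta> = 0 and \<phi> would have scalar values only.\<close>
  have \<theta>_1: "\<theta> 1 = 1"
  proof -
    obtain c where c: "\<theta> 1 = cs c 1"
      by (simp add: \<theta>_def one scale_left_distrib [symmetric])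
    then have "cs c 1 = cs (c * c) 1"
      using \<theta>_sq [of 1] by simp
    then have "c = 0 \<or> c = 1"
      by simp
    moreover have "c \<noteq> 0"
    proof
      assume "c = 0"
      then have 0: "\<theta> 1 = 0"
        using c by simp
      have "\<theta> x + \<theta> x = 0" for x
        using \<theta>_sq [of "x + 1"] 0 by (simp add: \<theta>_add \<theta>_sq algebra_simps)
      then have "\<theta> x = 0" for x
        by (rule double_eq_0)
      then have "\<phi> t' = cs (- m t' / (2 * \<kappa>)) 1"
        using \<phi>_\<theta> [of t'] by simp
      then show False
        using t by (simp add: t' capelli_def)
    qed
    ultimately show ?thesis
      using c by simp
  qed
  have "surj \<theta>"
  proof (rule surjI)
    fix y
    define x where "x = \<psi> (cs (1/\<kappa>) y)"
    have "\<theta> x = y + cs (m x / 2) 1"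
      using \<kappa> by (simp add: \<theta>_def x_def \<phi>\<psi>)
    then show "\<theta> (\<psi> (cs (1/\<kappa>) y) + cs (- m (\<psi> (cs (1/\<kappa>) y)) / 2) 1) = y"
      by (simp only: \<theta>_add \<theta>_cs \<theta>_1 x_def) simp
  qed
  moreover have "inj \<theta>"
  proof (rule injI)
    fix x y
    assume "\<theta> x = \<theta> y"
    moreover have "\<theta> (x + cs (- 1) y) = \<theta> x + cs (- 1) (\<theta> y)"
      by (simp only: \<theta>_add \<theta>_cs)
    ultimately have 0: "\<theta> (x - y) = 0"
      by simp
    then have "\<phi> (x - y) = \<phi> (cs (- m (x - y) / (2 * \<kappa>)) 1)"
      using \<phi>_\<theta> [of "x - y"] 0 unfolding cs one by simp
    then obtain c where c: "x - y = cs c 1"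
      by (simp only: inj)
    then have "c = 0"
      using 0 by (simp add: \<theta>_cs \<theta>_1)
    then show "x = y"
      using c by simp
  qed
  ultimately have "bij \<theta>"
    by (simp add: bij_def)
  moreover have "(\<forall>x y. \<theta> (x * y) = \<theta> x * \<theta> y) \<or> (\<forall>x y. \<theta> (x * y) = \<theta> y * \<theta> x)"
    using jordan_hom_onto_prime [of \<theta>, OF \<theta>_add \<theta>_sq \<open>surj \<theta>\<close>] .
  ultimately have "automorphism cs \<theta> \<or> antiautomorphism cs \<theta>"
    unfolding automorphism_def antiautomorphism_def clinear_map_def
    using \<theta>_add \<theta>_cs by blast
  moreover have "clinear_map cs (*) (\<lambda>a. - m a / (2 * \<kappa>))"
    by (simp add: clinear_map_def m_add m_cs add_divide_distrib)
  ultimately show ?thesis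
    using \<phi>_\<theta> by blast
qed

end

section \<open>Quadratic algebras\<close>

context centrally_closed_prime
begin

lemma idempotent_of_eigenvalue:
  fixes m :: 'a
  assumes "m * m = cs \<delta> m" "\<delta> \<noteq> 0" "m \<noteq> 0" "m \<noteq> cs \<delta> 1"
  shows "\<exists>e::'a. e * e = e \<and> e \<noteq> 0 \<and> e \<noteq> 1"
proof (intro exI [of _ "cs (1/\<delta>) m"] conjI)
  show "cs (1/\<delta>) m * cs (1/\<delta>) m = cs (1/\<delta>) m" "cs (1/\<delta>) m \<noteq> 0"
    using assms by simp_all
  show "cs (1/\<delta>) m \<noteq> 1"
  proof
    assume "cs (1/\<delta>) m = 1"
    then have "cs \<delta> (cs (1/\<delta>) m) = cs \<delta> 1"
      by simp
    then show False
      using assms by simp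
  qed
qed

text \<open>Subtracting a root of its quadratic from \<open>t\<close> gives \<open>n\<close> with
  \<open>n * n = cs s n\<close>, where \<open>s\<close> is the difference of the two roots. If
  \<open>s\<close> is nonzero, rescale \<open>n\<close>. If \<open>n\<close> has square 0, some
  \<open>n * x\<close> takes its place, since primeness forbids that all of them have square
  0.\<close>

lemma exists_idempotent:
  assumes quad: "\<And>t. \<exists>\<alpha> \<beta>. t * t = cs \<alpha> t + cs \<beta> 1"
    and t: "\<nexists>c. t = cs c 1"
  shows "\<exists>e::'a. e * e = e \<and> e \<noteq> 0 \<and> e \<noteq> 1"
proof -
  obtain \<alpha> \<beta> where t2: "t * t = cs \<alpha> t + cs \<beta> 1"
    using quad by blast
  define s where "s = csqrt (\<alpha>\<^sup>2 + 4 * \<beta>)"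
  define r where "r = (\<alpha> - s) / 2"
  define n where "n = t - cs r 1"
  have s2: "s * s = \<alpha> * \<alpha> + 4 * \<beta>"
    using power2_csqrt [of "\<alpha>\<^sup>2 + 4 * \<beta>"] by (simp add: s_def power2_eq_square)
  have \<beta>: "\<beta> = - (r * (s + r))"
    using s2 by (simp add: r_def field_simps)
  have \<alpha>: "s + r + r = \<alpha>"
    by (simp add: r_def field_simps)
  have n2: "n * n = cs s n"
  proof -
    have "n * n = t * t - cs r t - cs r t + cs (r * r) 1"
      by (simp add: n_def algebra_simps)
    then show ?thesis
      unfolding t2 n_def \<alpha> [symmetric] \<beta> scale_left_distrib by (simp add: algebra_simps)
  qed
  have n0: "n \<noteq> cs c 1" for c
  proof
    assume "n = cs c 1"
    then have "t = cs (c + r) 1"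
      by (simp add: n_def algebra_simps)
    then show False
      using t by blast
  qed
  have n_nz: "n \<noteq> 0"
    using n0 [of 0] by simp
  show ?thesis
  proof (cases "s = 0")
    case False
    then show ?thesis
      by (rule idempotent_of_eigenvalue [OF n2 _ n_nz n0])
  next
    case True
    then have nn: "n * n = 0"
      using n2 by simp
    have ex: "\<exists>\<alpha>. (n * x) * (n * x) = cs \<alpha> (n * x)" for x
    proof -
      obtain \<alpha> \<beta> where *: "(n * x) * (n * x) = cs \<alpha> (n * x) + cs \<beta> 1"
        using quad by blast
      have "n * ((n * x) * (n * x)) = 0" "n * (n * x) = 0"
        using nn by (simp_all add: mult.assoc [symmetric])
      then have "cs \<beta> n = 0"
        unfolding * by (simp add: distrib_left)
      then show ?thesis
        using * n_nz by auto
    qed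
    show ?thesis
    proof (cases "\<forall>x. (n * x) * (n * x) = 0")
      case True
      have lin: "n * x * n * y + n * y * n * x = 0" for x y
        using True [rule_format, of "x + y"] True [rule_format, of x] True [rule_format, of y]
        by (simp add: algebra_simps)
      \<comment> \<open>Putting \<open>y * n\<close> for \<open>y\<close> annihilates the second
        term of \<open>lin\<close>.\<close>
      have "(n * x * n) * y * n = 0" for x y
        using lin [of x "y * n"] nn by (metis add.right_neutral mult.assoc mult_zero_left mult_zero_right)
      then have "n * x * n = 0" for x
        using prime [of "n * x * n" n] n_nz by blast
      then show ?thesis
        using prime [of n n] n_nz by blast
    next
      case False
      then obtain x where x: "(n * x) * (n * x) \<noteq> 0"
        by blast
      obtain \<delta> where \<delta>: "(n * x) * (n * x) = cs \<delta> (n * x)"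
        using ex by blast
      have "\<delta> \<noteq> 0" "n * x \<noteq> 0"
        using x \<delta> by auto
      moreover have "n * x \<noteq> cs \<delta> 1"
      proof
        assume "n * x = cs \<delta> 1"
        then have "n * (n * x) = cs \<delta> n"
          by simp
        then show False
          using nn n_nz \<open>\<delta> \<noteq> 0\<close> by (simp add: mult.assoc [symmetric])
      qed
      ultimately show ?thesis
        using idempotent_of_eigenvalue [OF \<delta>] by blast
    qed
  qed
qed

text \<open>In the corner of \<open>e\<close> the quadratic relation has no constant term. Comparing
  those of z and z + e, for z not a multiple of e, forces z^2 = -z. This would hold for y and for
  2y, which is possible only if y = 0.\<close>

lemma corner_scalar:
  assumes quad: "\<And>t. \<exists>\<alpha> \<beta>. t * t = cs \<alpha> t + cs \<beta> 1"
    and e: "e * e = e" "e \<noteq> 0" "e \<noteq> 1"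
  shows "\<exists>c. e * x * e = cs c e"
proof (rule ccontr)
  assume no: "\<not> ?thesis"
  define y where "y = e * x * e"
  have ey: "e * y = y" "y * e = y"
    using e by (simp_all add: y_def mult.assoc, simp_all add: mult.assoc [symmetric])
  have sq: "\<exists>\<alpha>. z * z = cs \<alpha> z" if z: "e * z = z" for z
  proof -
    obtain \<alpha> \<beta> where *: "z * z = cs \<alpha> z + cs \<beta> 1"
      using quad by blast
    have "(1 - e) * z = 0"
      using z by (simp add: left_diff_distrib)
    then have "(1 - e) * (z * z) = 0"
      by (simp add: mult.assoc [symmetric])
    then have "cs \<beta> (1 - e) = 0"
      using \<open>(1 - e) * z = 0\<close> unfolding * by (simp add: distrib_left)
    then show ?thesis
      using * e by auto
  qed
  have neg: "z * z = - z" if z: "e * z = z" "z * e = z" "\<nexists>c. z = cs c e" for z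
  proof -
    obtain \<alpha> where \<alpha>: "z * z = cs \<alpha> z"
      using sq z by blast
    obtain \<alpha>' where "(z + e) * (z + e) = cs \<alpha>' (z + e)"
      using sq [of "z + e"] z e by (auto simp: distrib_left)
    then have *: "cs (\<alpha> + 1 + 1 - \<alpha>') z = cs (\<alpha>' - 1) e"
      by (simp only: scale_left_distrib scale_left_diff_distrib scale_one)
        (simp add: \<alpha> z e algebra_simps)
    have "\<alpha> + 1 + 1 - \<alpha>' = 0"
    proof (rule ccontr)
      assume nz: "\<alpha> + 1 + 1 - \<alpha>' \<noteq> 0"
      then have "z = cs (1 / (\<alpha> + 1 + 1 - \<alpha>')) (cs (\<alpha> + 1 + 1 - \<alpha>') z)"
        by simp
      then show False
        using z(3) unfolding * by (simp only: scale_scale) blast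
    qed
    moreover from this have "\<alpha>' = 1"
      using * e by simp
    ultimately have "\<alpha> = - 1"
      by (simp add: algebra_simps eq_neg_iff_add_eq_0)
    then show ?thesis
      using \<alpha> by simp
  qed
  have y: "y * y = - y"
    using neg [OF ey] no by (simp add: y_def)
  have "(y + y) * (y + y) = - (y + y)"
  proof (rule neg)
    show "\<nexists>c. y + y = cs c e"
    proof
      assume "\<exists>c. y + y = cs c e"
      then obtain c where "y + y = cs c e"
        by blast
      then have "cs (1/2) (y + y) = cs (1/2) (cs c e)"
        by simp
      then have "y = cs (c/2) e"
        using scale_left_distrib [of "1/2" "1/2" y] by (simp add: scale_right_distrib)
      then show False
        using no unfolding y_def by blast
    qed
  qed (simp_all add: distrib_left distrib_right ey)
  moreover have "(y + y) * (y + y) = - (y + y) - (y + y)"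
    by (simp only: distrib_left distrib_right y) simp
  ultimately have "y + y = 0"
    by (simp only: diff_eq_eq) (metis add_cancel_right_right)
  then have "y = cs 0 e"
    using double_eq_0 [of y] by simp
  then show False
    using no by (auto simp: y_def)
qed

text \<open>An idempotent \<open>e\<close> and its complement \<open>f\<close> are linked by
  off-diagonal \<open>u\<close>, \<open>v\<close> with \<open>u * v = e\<close> and
  \<open>v * u = f\<close>, giving a system of matrix units; the entries of a matrix are then read
  off in the corner of \<open>e\<close>, which is one-dimensional.\<close>

theorem quadratic_imp_M2:
  assumes quad: "\<And>t. \<exists>\<alpha> \<beta>. t * t = cs \<alpha> t + cs \<beta> 1"
    and t: "\<nexists>c. t = cs c (1::'a)"
  shows "iso_M2 cs TYPE('a)"
proof -
  obtain e :: 'a where e: "e * e = e" "e \<noteq> 0" "e \<noteq> 1"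
    using exists_idempotent [OF quad t] by blast
  define f where "f = 1 - e"
  have f: "f * f = f" "f \<noteq> 0" "f \<noteq> 1" "e * f = 0" "f * e = 0"
    using e by (simp_all add: f_def algebra_simps)
  obtain x where x: "e * x * f \<noteq> 0"
    using prime [of e f] e f by blast
  define u where "u = e * x * f"
  have u: "u \<noteq> 0" "e * u = u" "u * f = u" "u * e = 0"
    using x e f by (simp_all add: u_def mult.assoc, simp_all add: mult.assoc [symmetric])
  obtain z where z: "u * z * e \<noteq> 0"
    using prime [of u e] e u by blast
  obtain l where l: "u * z * e = cs l e"
    using corner_scalar [OF quad e, of "u * z"] u by (metis mult.assoc)
  have l0: "l \<noteq> 0"
    using z l by auto
  define v where "v = cs (1/l) (f * z * e)"
  have ef0: "e * (f * a) = 0" "u * (f * a) = u * a" for a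
    using f u by (simp_all add: mult.assoc [symmetric])
  have v: "v * e = v" "f * v = v" "e * v = 0"
    using e f ef0 by (simp_all add: v_def mult.assoc, simp add: mult.assoc [symmetric])
  have uv: "u * v = e"
    using l l0 by (simp add: v_def ef0 mult.assoc)
  have vu: "v * u = f"
  proof -
    have "f * (v * u) * f = v * u"
      using v u by (simp add: mult.assoc) (simp add: mult.assoc [symmetric])
    then obtain \<mu> where \<mu>: "v * u = cs \<mu> f"
      using corner_scalar [OF quad f(1-3), of "v * u"] by auto
    have "u * (v * u) = u"
      using uv u by (simp add: mult.assoc [symmetric])
    then have "cs \<mu> u = cs 1 u"
      using \<mu> u by simp
    then have "\<mu> = 1"
      using u(1) by (simp only: scale_cancel_right) simp
    then show ?thesis
      using \<mu> by simp
  qed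
  \<comment> \<open>Row and column vectors over the corner of \<open>e\<close>:
    \<open>p i * q j\<close> is \<delta> times \<open>e\<close>, the \<open>q i * p i\<close> sum to
    1, and the \<open>q i * p j\<close> are the matrix units.\<close>
  define p where "p = (\<lambda>i::2. if i = 1 then e else u)"
  define q where "q = (\<lambda>i::2. if i = 1 then e else v)"
  have neq: "(2::2) \<noteq> 1" "(1::2) \<noteq> 2"
    by simp_all
  have ep: "e * p i = p i" and qe: "q i * e = q i" for i
    using e u v by (simp_all add: p_def q_def)
  have pq: "p i * q j = (if i = j then e else 0)" for i j
    using exhaust_2 [of i] exhaust_2 [of j] e u v uv by (auto simp: p_def q_def)
  have qp: "(\<Sum>i\<in>UNIV. q i * p i) = 1"
    by (simp add: sum_2 p_def q_def e vu f_def)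
  define k where "k x i j = (SOME c. p i * x * q j = cs c e)" for x i j
  have "\<exists>c. p i * x * q j = cs c e" for i j x
    using corner_scalar [OF quad e, of "p i * x * q j"]
    by (simp add: mult.assoc qe) (simp add: mult.assoc [symmetric] ep)
  then have k: "p i * x * q j = cs (k x i j) e" for x i j
    unfolding k_def by (rule someI_ex)
  have k_eqI: "k x i j = c" if "p i * x * q j = cs c e" for x i j c
    using that e unfolding k by simp
  define h :: "'a \<Rightarrow> complex^2^2" where "h x = (\<chi> i j. k x i j)" for x
  have recover: "x = (\<Sum>i\<in>UNIV. \<Sum>j\<in>UNIV. cs (k x i j) (q i * p j))" for x
  proof -
    have "x = (\<Sum>i\<in>UNIV. q i * p i) * x * (\<Sum>j\<in>UNIV. q j * p j)"
      by (simp add: qp)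
    also have "\<dots> = (\<Sum>i\<in>UNIV. \<Sum>j\<in>UNIV. q i * (p i * x * q j) * p j)"
      by (simp add: sum_distrib_left sum_distrib_right mult.assoc) (rule sum.swap)
    also have "\<dots> = (\<Sum>i\<in>UNIV. \<Sum>j\<in>UNIV. cs (k x i j) (q i * p j))"
      unfolding k by (simp add: qe)
    finally show ?thesis .
  qed
  have "bij h"
  proof (rule bijI)
    show "inj h"
    proof (rule injI)
      fix x y
      assume "h x = h y"
      then have "k x i j = k y i j" for i j
        by (simp add: h_def vec_eq_iff)
      then show "x = y"
        using recover [of x] recover [of y] by simp
    qed
    show "surj h"
    proof (rule surjI)
      fix M :: "complex^2^2"
      have "k (\<Sum>i\<in>UNIV. \<Sum>j\<in>UNIV. cs (M $ i $ j) (q i * p j)) a b = M $ a $ b" for a b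
      proof (rule k_eqI)
        have "p a * (q i * p j) * q b = (if i = a \<and> j = b then e else 0)" for i j
        proof -
          have "p a * (q i * p j) * q b = (p a * q i) * (p j * q b)"
            by (simp add: mult.assoc)
          then show ?thesis
            by (auto simp: pq e)
        qed
        then show "p a * (\<Sum>i\<in>UNIV. \<Sum>j\<in>UNIV. cs (M $ i $ j) (q i * p j)) * q b = cs (M $ a $ b) e"
          using exhaust_2 [of a] exhaust_2 [of b]
          by (auto simp: sum_2 distrib_left distrib_right)
      qed
      then show "h (\<Sum>i\<in>UNIV. \<Sum>j\<in>UNIV. cs (M $ i $ j) (q i * p j)) = M"
        by (simp add: h_def vec_eq_iff)
    qed
  qed
  moreover have "clinear_map cs (\<lambda>c M. \<chi> i j. c * M $ i $ j) h"
  proof -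
    have "k (x + y) i j = k x i j + k y i j" for x y i j
      by (rule k_eqI) (simp add: distrib_left distrib_right k scale_left_distrib)
    moreover have "k (cs c x) i j = c * k x i j" for c x i j
      by (rule k_eqI) (simp add: k)
    ultimately show ?thesis
      by (simp add: clinear_map_def h_def vec_eq_iff)
  qed
  moreover have "h (x * y) = h x ** h y" for x y
  proof -
    have "k (x * y) i j = (\<Sum>l\<in>UNIV. k x i l * k y l j)" for i j
    proof (rule k_eqI)
      have "p i * (x * y) * q j = p i * x * (\<Sum>l\<in>UNIV. q l * p l) * y * q j"
        by (simp add: qp mult.assoc)
      also have "\<dots> = (\<Sum>l\<in>UNIV. (p i * x * q l) * (p l * y * q j))"
        by (simp add: sum_distrib_left sum_distrib_right mult.assoc)
      also have "\<dots> = cs (\<Sum>l\<in>UNIV. k x i l * k y l j) e"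
        unfolding k by (simp add: e scale_sum_left mult.commute)
      finally show "p i * (x * y) * q j = cs (\<Sum>l\<in>UNIV. k x i l * k y l j) e" .
    qed
    then show ?thesis
      by (simp add: h_def matrix_matrix_mult_def)
  qed
  ultimately show ?thesis
    unfolding iso_M2_def by blast
qed

end

section \<open>The extended centroid of a prime C*-algebra\<close>

text \<open>\<open>1 - y\<close> is a square root of \<open>1 - h\<close>. The iteration is dominated by the scalar one for \<open>h = 1\<close>, which
  increases to \<open>1\<close>; thus it converges even if \<open>norm h = 1\<close>.\<close>
lemma quadratic_fixed_point:
  fixes h :: "'a::{banach,real_normed_algebra_1}"
  assumes h: "norm h \<le> 1"
    and S: "closed S" "0 \<in> S" "\<And>u. u \<in> S \<Longrightarrow> (1/2) *\<^sub>R (h + u * u) \<in> S"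
  shows "\<exists>y\<in>S. y = (1/2) *\<^sub>R (h + y * y) \<and> norm y \<le> 1"
proof -
  define y where "y = rec_nat (0::'a) (\<lambda>_ u. (1/2) *\<^sub>R (h + u * u))"
  have y_0: "y 0 = 0" and y_Suc: "y (Suc n) = (1/2) *\<^sub>R (h + y n * y n)" for n
    by (simp_all add: y_def)
  define \<eta> where "\<eta> = rec_nat (0::real) (\<lambda>_ u. (1 + u * u) / 2)"
  have \<eta>_0: "\<eta> 0 = 0" and \<eta>_Suc: "\<eta> (Suc n) = (1 + \<eta> n * \<eta> n) / 2" for n
    by (simp_all add: \<eta>_def)
  have \<eta>: "0 \<le> \<eta> n \<and> \<eta> n \<le> 1" for n
  proof (induction n)
    case (Suc n)
    then have "\<eta> n * \<eta> n \<le> 1 * 1"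
      by (intro mult_mono) auto
    then show ?case
      by (simp add: \<eta>_Suc)
  qed (simp add: \<eta>_0)
  have \<eta>_mono: "\<eta> n \<le> \<eta> (Suc n)" for n
    using sum_squares_ge_zero [of "1 - \<eta> n" 0] by (simp add: \<eta>_Suc algebra_simps)
  have y_norm: "norm (y n) \<le> \<eta> n" for n
  proof (induction n)
    case (Suc n)
    have "norm (y n * y n) \<le> \<eta> n * \<eta> n"
      by (rule order_trans [OF norm_mult_ineq]) (intro mult_mono Suc, use \<eta> in auto)
    then show ?case
      using norm_triangle_ineq [of h "y n * y n"] h by (simp add: y_Suc \<eta>_Suc)
  qed (simp add: y_0 \<eta>_0)
  \<comment> \<open>Whatever commutes with \<open>h\<close> commutes with the iterates. Hence these
    commute mutually, and the difference of consecutive squares factors in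
    \<open>step\<close>.\<close>
  have comm: "c * y n = y n * c" if c: "c * h = h * c" for c n
  proof (induction n)
    case (Suc n)
    have "c * (y n * y n) = (y n * y n) * c"
      by (metis Suc mult.assoc)
    then show ?case
      using c by (simp add: y_Suc distrib_left distrib_right)
  qed (simp add: y_0)
  have yy: "y m * y n = y n * y m" for m n
    by (rule comm) (simp add: comm [of h m])
  have step: "norm (y (Suc n) - y n) \<le> \<eta> (Suc n) - \<eta> n" for n
  proof (induction n)
    case 0
    then show ?case
      using h by (simp add: y_Suc y_0 \<eta>_0 \<eta>_Suc)
  next
    case (Suc n)
    have "y (Suc (Suc n)) - y (Suc n) = (1/2) *\<^sub>R ((y (Suc n) + y n) * (y (Suc n) - y n))"
    proof -
      have "(y (Suc n) + y n) * (y (Suc n) - y n) = y (Suc n) * y (Suc n) - y n * y n"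
        using yy [of n "Suc n"] by (simp add: algebra_simps)
      then show ?thesis
        unfolding y_Suc [of "Suc n"] using y_Suc [of n]
        by (simp add: scaleR_diff_right [symmetric])
    qed
    then have "norm (y (Suc (Suc n)) - y (Suc n)) \<le> (1/2) * (norm (y (Suc n) + y n) * norm (y (Suc n) - y n))"
      by (simp add: norm_mult_ineq)
    also have "\<dots> \<le> (1/2) * ((\<eta> (Suc n) + \<eta> n) * (\<eta> (Suc n) - \<eta> n))"
      using Suc \<eta>_mono [of n] \<eta>
      by (intro mult_left_mono mult_mono order_trans [OF norm_triangle_ineq] add_mono y_norm) auto
    also have "\<dots> = \<eta> (Suc (Suc n)) - \<eta> (Suc n)"
      by (simp add: \<eta>_Suc [of "Suc n"]) (simp add: \<eta>_Suc field_simps)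
    finally show ?case .
  qed
  have tele: "norm (y (m + k) - y m) \<le> \<eta> (m + k) - \<eta> m" for m k
  proof (induction k)
    case (Suc k)
    show ?case
      using norm_triangle_ineq [of "y (m + Suc k) - y (m + k)" "y (m + k) - y m"] Suc step [of "m + k"]
      by simp
  qed simp
  have "convergent \<eta>"
  proof (rule Bseq_mono_convergent)
    show "Bseq \<eta>"
      using \<eta> by (intro BseqI' [of _ 1]) auto
    show "\<forall>m n. m \<le> n \<longrightarrow> \<eta> m \<le> \<eta> n"
      using lift_Suc_mono_le [of \<eta>, OF \<eta>_mono] by blast
  qed
  then have "Cauchy \<eta>"
    by (rule convergent_Cauchy)
  have "Cauchy y"
  proof (rule CauchyI')
    fix e :: real
    assume "0 < e"
    then obtain M where M: "\<And>m n. m \<ge> M \<Longrightarrow> n \<ge> M \<Longrightarrow> norm (\<eta> m - \<eta> n) < e"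
      using \<open>Cauchy \<eta>\<close> unfolding Cauchy_iff by blast
    show "\<exists>M. \<forall>m\<ge>M. \<forall>n>m. dist (y m) (y n) < e"
    proof (intro exI [of _ M] allI impI)
      fix m n
      assume "M \<le> m" "m < n"
      then have "norm (y n - y m) \<le> \<eta> n - \<eta> m" "\<eta> n - \<eta> m < e"
        using tele [of m "n - m"] M [of n m] by simp_all
      then show "dist (y m) (y n) < e"
        by (simp add: dist_norm norm_minus_commute)
    qed
  qed
  then obtain L where L: "y \<longlonglongrightarrow> L"
    using convergent_eq_Cauchy convergent_def by blast
  have "y n \<in> S" for n
    by (induction n) (simp_all add: y_0 y_Suc S)
  then have "L \<in> S"
    using closed_sequentially [OF S(1), of y L] L by blast
  moreover have "L = (1/2) *\<^sub>R (h + L * L)"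
  proof (rule LIMSEQ_unique)
    show "(\<lambda>n. y (Suc n)) \<longlonglongrightarrow> L"
      using L by (rule LIMSEQ_Suc)
    show "(\<lambda>n. y (Suc n)) \<longlonglongrightarrow> (1/2) *\<^sub>R (h + L * L)"
      unfolding y_Suc by (intro tendsto_intros L)
  qed
  moreover have "norm L \<le> 1"
    by (rule LIMSEQ_le_const2 [OF tendsto_norm [OF L]]) (use y_norm \<eta> order_trans in blast)
  ultimately show ?thesis
    by blast
qed

text \<open>The set \<open>S\<close> tracks where the geometric series lives, so that the inverse
  stays in a closed subalgebra.\<close>

lemma neumann_inverse:
  fixes x :: "'a::{banach,real_normed_algebra_1}"
  assumes x: "norm x < 1"
    and S: "closed S" "1 \<in> S" "\<And>u v. u \<in> S \<Longrightarrow> v \<in> S \<Longrightarrow> u + v \<in> S" "\<And>u. u \<in> S \<Longrightarrow> x * u \<in> S"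
  shows "\<exists>g\<in>S. (1 - x) * g = 1"
proof -
  have sm: "summable (\<lambda>n. x ^ n)"
    using x by (rule complete_algebra_summable_geometric)
  define g where "g = (\<Sum>n. x ^ n)"
  have pow: "x ^ n \<in> S" for n
    by (induction n) (simp_all add: S)
  have "(\<Sum>n<Suc k. x ^ n) \<in> S" for k
    by (induction k) (use S pow in auto)
  moreover have "(\<lambda>k. \<Sum>n<Suc k. x ^ n) \<longlonglongrightarrow> g"
    using summable_LIMSEQ [OF sm] unfolding g_def by (rule LIMSEQ_Suc)
  ultimately have "g \<in> S"
    using closed_sequentially [OF S(1), of "\<lambda>k. \<Sum>n<Suc k. x ^ n" g] by blast
  moreover have "(1 - x) * g = 1"
  proof -
    have "x * g = (\<Sum>n. x ^ Suc n)"
      unfolding g_def using suminf_mult [OF sm, of x] by simp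
    also have "\<dots> = g - 1"
      unfolding g_def using suminf_split_head [OF sm] by simp
    finally show ?thesis
      by (simp add: left_diff_distrib)
  qed
  ultimately show ?thesis
    by blast
qed

section \<open>Self-adjoint elements of a C*-algebra and their square roots\<close>

locale cstar =
  fixes cs :: "complex \<Rightarrow> 'a::{banach,real_normed_algebra_1} \<Rightarrow> 'a"
    and st :: "'a \<Rightarrow> 'a"
  assumes cstar: "cstar_algebra cs st"
begin

lemma cs_of_real: "cs (complex_of_real r) x = r *\<^sub>R x"
  and cs_add_left: "cs (a + b) x = cs a x + cs b x"
  and cs_add_right: "cs a (x + y) = cs a x + cs a y"
  and cs_cs: "cs a (cs b x) = cs (a * b) x"
  and mult_cs: "cs a x * y = cs a (x * y)" "x * cs a y = cs a (x * y)"
  and st_st: "st (st x) = x"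
  and st_add: "st (x + y) = st x + st y"
  and st_cs: "st (cs a x) = cs (cnj a) (st x)"
  and st_mult: "st (x * y) = st y * st x"
  and norm_st_mult: "norm (st x * x) = (norm x)\<^sup>2"
proof -
  have *: "\<forall>r x. cs (complex_of_real r) x = r *\<^sub>R x"
    "\<forall>a b x. cs (a + b) x = cs a x + cs b x"
    "\<forall>a x y. cs a (x + y) = cs a x + cs a y"
    "\<forall>a b x. cs (a * b) x = cs a (cs b x)"
    "\<forall>a x y. cs a x * y = cs a (x * y)" "\<forall>a x y. x * cs a y = cs a (x * y)"
    "\<forall>x. st (st x) = x"
    "\<forall>x y. st (x + y) = st x + st y"
    "\<forall>a x. st (cs a x) = cs (cnj a) (st x)"
    "\<forall>x y. st (x * y) = st y * st x"
    "\<forall>x. norm (st x * x) = (norm x)\<^sup>2"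
    using cstar unfolding cstar_algebra_def by auto metis+
  show "cs (complex_of_real r) x = r *\<^sub>R x" "cs (a + b) x = cs a x + cs b x"
    "cs a (x + y) = cs a x + cs a y" "cs a (cs b x) = cs (a * b) x"
    "cs a x * y = cs a (x * y)" "x * cs a y = cs a (x * y)"
    "st (st x) = x" "st (x + y) = st x + st y" "st (cs a x) = cs (cnj a) (st x)"
    "st (x * y) = st y * st x" "norm (st x * x) = (norm x)\<^sup>2"
    using *(1) *(2) *(3) *(4) *(5) *(6) *(7) *(8) *(9) *(10) *(11) by simp_all
qed

lemma cs_diff_right: "cs a (x - y) = cs a x - cs a y"
  using cs_add_right [of a "x - y" y] by simp

lemma st_scaleR: "st (r *\<^sub>R x) = r *\<^sub>R st x"
  using st_cs [of "complex_of_real r" x] by (simp add: cs_of_real)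

lemma st_minus: "st (- x) = - st x"
  using st_scaleR [of "-1" x] by simp

lemma st_diff: "st (x - y) = st x - st y"
  using st_add [of x "- y"] by (simp add: st_minus)

lemma st_1: "st 1 = 1"
  using st_mult [of "st 1" 1] by (simp add: st_st)

lemma norm_st: "norm (st x) = norm x"
proof -
  have le: "norm x \<le> norm (st x)" for x
  proof (cases "x = 0")
    case False
    have "norm x * norm x \<le> norm (st x) * norm x"
      using norm_mult_ineq [of "st x" x] norm_st_mult [of x] by (simp add: power2_eq_square)
    then show ?thesis
      using False by simp
  qed simp
  show ?thesis
    using le [of x] le [of "st x"] by (simp add: st_st)
qed

lemma continuous_on_st: "continuous_on A st"
  by (auto simp: continuous_on_iff dist_norm norm_st simp flip: st_diff)

text \<open>A stand-in for real continuous functions on a compact space. Commutativity is automatic,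
  since products of members are again self-adjoint.\<close>

definition hermitian_subalgebra :: "'a set \<Rightarrow> bool" where
  "hermitian_subalgebra S \<longleftrightarrow> closed S \<and> 1 \<in> S \<and> (\<forall>x\<in>S. \<forall>y\<in>S. x + y \<in> S \<and> x * y \<in> S) \<and>
     (\<forall>r. \<forall>x\<in>S. r *\<^sub>R x \<in> S) \<and> (\<forall>x\<in>S. st x = x)"

lemma hermitian_subalgebraD:
  assumes "hermitian_subalgebra S"
  shows "closed S" "1 \<in> S" "0 \<in> S" "x \<in> S \<Longrightarrow> y \<in> S \<Longrightarrow> x + y \<in> S" "x \<in> S \<Longrightarrow> y \<in> S \<Longrightarrow> x - y \<in> S"
    "x \<in> S \<Longrightarrow> y \<in> S \<Longrightarrow> x * y \<in> S" "x \<in> S \<Longrightarrow> r *\<^sub>R x \<in> S" "x \<in> S \<Longrightarrow> st x = x"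
proof -
  show 0: "0 \<in> S"
    using assms unfolding hermitian_subalgebra_def by (metis scaleR_zero_left)
  show "x - y \<in> S" if "x \<in> S" "y \<in> S"
  proof -
    have "x + (- 1) *\<^sub>R y \<in> S"
      using assms that unfolding hermitian_subalgebra_def by blast
    then show ?thesis
      by simp
  qed
qed (use assms in \<open>auto simp: hermitian_subalgebra_def\<close>)

lemma hermitian_subalgebra_commute:
  assumes "hermitian_subalgebra S" "x \<in> S" "y \<in> S"
  shows "x * y = y * x"
  using st_mult [of x y] hermitian_subalgebraD(6,8) [OF assms(1)] assms(2,3) by simp

lemma hermitian_norm_square:
  assumes "st x = x"
  shows "norm (x * x) = (norm x)\<^sup>2"
  using norm_st_mult [of x] assms by simp

text \<open>With \<open>w = x + \<i> y\<close> one has \<open>w\<^sup>* w = x\<^sup>2 + y\<^sup>2\<close> and \<open>x = (w + w\<^sup>*) / 2\<close>. This replaces the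
  positivity of sums of squares, so that no spectral theory is needed.\<close>
lemma norm_le_sum_squares:
  assumes "st x = x" "st y = y" "x * y = y * x"
  shows "(norm x)\<^sup>2 \<le> norm (x * x + y * y)"
proof -
  define w where "w = x + cs \<i> y"
  have m: "cs (- \<i>) z = - cs \<i> z" for z
  proof -
    have "cs (- \<i>) z + cs \<i> z = 0"
      using cs_add_left [of "- \<i>" \<i> z] cs_of_real [of 0 z] by simp
    then show ?thesis
      by (simp add: eq_neg_iff_add_eq_0)
  qed
  have st_w: "st w = x - cs \<i> y"
    by (simp add: w_def st_add st_cs assms m)
  have "cs \<i> (cs \<i> (y * y)) = - (y * y)"
    using cs_of_real [of "-1" "y * y"] by (simp add: cs_cs)
  then have "st w * w = x * x + y * y"
    unfolding st_w by (simp add: w_def algebra_simps mult_cs cs_add_right cs_diff_right assms(3))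
  then have w: "norm (x * x + y * y) = (norm w)\<^sup>2"
    using norm_st_mult [of w] by simp
  have "w + st w = 2 *\<^sub>R x"
    unfolding st_w by (simp add: w_def scaleR_2)
  then have "2 * norm x \<le> norm w + norm (st w)"
    by (metis norm_triangle_ineq norm_scaleR abs_numeral)
  then have "norm x \<le> norm w"
    by (simp add: norm_st)
  then show ?thesis
    unfolding w by (simp add: power_mono)
qed

text \<open>The bound on \<open>1 - k\<close> says that \<open>k\<close> is again of the form 1 - h'
  with norm h' \<le> 1, so that roots can be taken repeatedly.\<close>

lemma hermitian_sqrt:
  assumes S: "hermitian_subalgebra S" and h: "h \<in> S" "norm h \<le> 1"
  shows "\<exists>k\<in>S. k * k = 1 - h \<and> norm (1 - k) \<le> 1"
proof -
  note D = hermitian_subalgebraD [OF S]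
  obtain y where y: "y \<in> S" "y = (1/2) *\<^sub>R (h + y * y)" "norm y \<le> 1"
    using quadratic_fixed_point [OF h(2) D(1,3) D(7) [OF D(4) [OF h(1) D(6)]]] by blast
  have "2 *\<^sub>R y = 2 *\<^sub>R ((1/2) *\<^sub>R (h + y * y))"
    using y(2) by (rule arg_cong)
  then have "y + y = h + y * y"
    by (simp add: scaleR_2)
  then have "(1 - y) * (1 - y) = 1 - h"
    by (simp add: algebra_simps)
  moreover have "1 - y \<in> S"
    using D y by blast
  ultimately show ?thesis
    using y(3) by (intro bexI [of _ "1 - y"]) auto
qed

text \<open>The absolute value is the root of 1 - k^2, where k is the root of 1 - w^2; the bound on
  k^2 comes from k^2 + w^2 = 1.\<close>

lemma hermitian_abs:
  assumes S: "hermitian_subalgebra S" and w: "w \<in> S" "norm w \<le> 1"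
  shows "\<exists>p\<in>S. p * p = w * w \<and> norm (1 - p) \<le> 1"
proof -
  note D = hermitian_subalgebraD [OF S]
  have "norm (w * w) \<le> 1"
    using w D by (simp add: hermitian_norm_square power_le_one)
  then obtain k where k: "k \<in> S" "k * k = 1 - w * w"
    using hermitian_sqrt [OF S D(6) [OF w(1) w(1)]] by blast
  have "norm (k * k) \<le> norm (k * k + w * w)"
    using norm_le_sum_squares [of k w] D(8) k(1) w(1) hermitian_subalgebra_commute [OF S]
    by (simp add: hermitian_norm_square)
  then have "norm (k * k) \<le> 1"
    using k(2) by simp
  then show ?thesis
    using hermitian_sqrt [OF S D(6) [OF k(1) k(1)]] k(2) by force
qed

text \<open>Supplies a subalgebra containing two commuting self-adjoint elements. Its members
  commute with \<open>h\<close> and \<open>k\<close>, hence with each other, which makes their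
  products self-adjoint.\<close>

lemma hermitian_subalgebra_bicommutant:
  assumes "st h = h" "st k = k" "h * k = k * h"
  shows "hermitian_subalgebra {z. st z = z \<and> (\<forall>c. c * h = h * c \<and> c * k = k * c \<longrightarrow> c * z = z * c)}"
    (is "hermitian_subalgebra ?S")
  unfolding hermitian_subalgebra_def
proof (intro conjI ballI allI)
  have "?S = {z. st z = z} \<inter> (\<Inter>c\<in>{c. c * h = h * c \<and> c * k = k * c}. {z. c * z = z * c})"
    by auto
  also have "closed \<dots>"
    by (intro closed_Int closed_INT ballI closed_Collect_eq continuous_on_st continuous_intros)
  finally show "closed ?S" .
  fix x y
  assume x: "x \<in> ?S" and y: "y \<in> ?S"
  have "x * h = h * x" "x * k = k * x"
    using x assms by simp_all
  then have "x * y = y * x"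
    using y by simp
  moreover have "c * (x * y) = (x * y) * c" if "c * h = h * c \<and> c * k = k * c" for c
    using x y that by simp (metis mult.assoc)
  ultimately show "x * y \<in> ?S"
    using x y by (simp add: st_mult)
  show "x + y \<in> ?S"
    using x y by (simp add: st_add algebra_simps)
qed (simp_all add: st_1 st_scaleR)

text \<open>Both \<open>h\<close> and \<open>- h\<close> are squares, and a vanishing sum of two
  commuting self-adjoint squares has zero summands.\<close>

lemma hermitian_not_both_contractive:
  assumes h: "st h = h" "norm (1 + h) \<le> 1" "norm (1 - h) \<le> 1"
  shows "h = 0"
proof -
  obtain S where S: "hermitian_subalgebra S" "h \<in> S"
    using hermitian_subalgebra_bicommutant [OF h(1) h(1) refl] h(1) by auto
  note D = hermitian_subalgebraD [OF S(1)]
  obtain k l where k: "k \<in> S" "k * k = h" and l: "l \<in> S" "l * l = - h"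
    using hermitian_sqrt [OF S(1) D(5) [OF D(2) S(2)] h(3)] hermitian_sqrt [OF S(1) D(4) [OF D(2) S(2)] h(2)]
    by force
  have "(norm k)\<^sup>2 \<le> norm (k * k + l * l)"
    using norm_le_sum_squares D(8) k l hermitian_subalgebra_commute [OF S(1)] by metis
  then have "k = 0"
    by (simp add: k l)
  then show ?thesis
    using k by simp
qed

text \<open>\<open>s\<close> is twice the positive part of \<open>h - \<epsilon>\<close>, and \<open>g\<close> inverts \<open>h\<close> on its support.\<close>
lemma positive_part:
  assumes S: "hermitian_subalgebra S" "h \<in> S" and h: "norm h \<le> 1/2" "\<not> norm (1 + h) \<le> 1"
  shows "\<exists>s\<in>S. \<exists>g\<in>S. s \<noteq> 0 \<and> g * h * s = s"
proof -
  note D = hermitian_subalgebraD [OF S(1)]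
  note comm = hermitian_subalgebra_commute [OF S(1)]
  \<comment> \<open>The bound 1/2 keeps \<open>norm w\<close> at most 1. Half the excess of
    \<open>norm (1 + h)\<close> over 1 ensures that \<open>s\<close> is nonzero, as
    \<open>s = 0\<close> would give norm (1 + h) \<le> 1 + \<epsilon>.\<close>
  define \<epsilon> where "\<epsilon> = min (1/2) ((norm (1 + h) - 1) / 2)"
  have \<epsilon>: "0 < \<epsilon>" "\<epsilon> \<le> 1/2" "1 + \<epsilon> < norm (1 + h)"
    using h(2) by (auto simp: \<epsilon>_def min_def field_simps)
  define w where "w = h - \<epsilon> *\<^sub>R 1"
  have wS: "w \<in> S"
    unfolding w_def by (intro D S(2))
  have "norm w \<le> 1"
    using norm_triangle_ineq4 [of h "\<epsilon> *\<^sub>R 1"] h(1) \<epsilon> by (simp add: w_def)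
  then obtain p where p: "p \<in> S" "p * p = w * w" "norm (1 - p) \<le> 1"
    using hermitian_abs [OF S(1) wS] by blast
  define s where "s = p + w"
  have "s \<noteq> 0"
  proof
    assume "s = 0"
    then have "1 + h = (1 - p) + \<epsilon> *\<^sub>R 1"
      by (simp add: s_def w_def algebra_simps add_eq_0_iff)
    then have "norm (1 + h) \<le> norm (1 - p) + norm (\<epsilon> *\<^sub>R (1::'a))"
      by (simp only: norm_triangle_ineq)
    then show False
      using p(3) \<epsilon> by simp
  qed
  have sS: "s \<in> S"
    unfolding s_def using D(4) p(1) wS .
  \<comment> \<open>From (p - w)(p + w) = 0: on \<open>s\<close>, \<open>h\<close> acts as p +
    \<epsilon>, which the Neumann series inverts.\<close>
  have "w * s = p * s"
    unfolding s_def using p(2) comm [OF p(1) wS] by (simp add: distrib_left add.commute)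
  then have hs: "h * s = (p + \<epsilon> *\<^sub>R 1) * s"
    by (simp add: w_def algebra_simps)
  define x where "x = (1 / (1 + \<epsilon>)) *\<^sub>R (1 - p)"
  have "norm x < 1"
    using p(3) \<epsilon> by (simp add: x_def)
  moreover have xS: "x \<in> S"
    unfolding x_def by (intro D p(1))
  ultimately obtain g where g: "g \<in> S" "(1 - x) * g = 1"
    using neumann_inverse [OF _ D(1,2,4) D(6) [OF xS]] by blast
  have v: "p + \<epsilon> *\<^sub>R 1 = (1 + \<epsilon>) *\<^sub>R (1 - x)"
    using \<epsilon> by (simp add: x_def algebra_simps)
  define g' where "g' = (1 / (1 + \<epsilon>)) *\<^sub>R g"
  have "g' * (p + \<epsilon> *\<^sub>R 1) = 1"
    using g comm [OF g(1), of "1 - x"] D(5) [OF D(2) xS] \<epsilon> unfolding v g'_def by simp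
  then have "g' * h * s = s"
    by (simp add: mult.assoc hs) (simp add: mult.assoc [symmetric])
  moreover have "g' \<in> S"
    unfolding g'_def by (intro D g(1))
  ultimately show ?thesis
    using sS \<open>s \<noteq> 0\<close> by blast
qed

end

section \<open>Primeness and triviality of the extended centroid\<close>

locale prime_cstar = cstar +
  assumes prime_algebra: "prime_algebra TYPE('a)"
begin

lemma prime: "(\<And>x. a * x * b = 0) \<Longrightarrow> a = 0 \<or> b = (0::'a)"
  using prime_algebra unfolding prime_algebra_def by blast

text \<open>The elements \<open>z\<close> with \<open>s x z s = z s x s\<close> act centrally on the ideal generated by \<open>s\<close>, so by
  primeness \<open>(\<bar>z - t\<bar> + (z - t)) s\<close> or \<open>(\<bar>z - t\<bar> - (z - t)) s\<close> vanishes for every real \<open>t\<close>.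
  Connectedness of the interval yields a \<open>t\<close> at which the sign changes, and \<open>z = t\<close> on this ideal.\<close>
lemma locally_central_scalar:
  assumes S: "hermitian_subalgebra S" "s \<in> S" "s \<noteq> 0" "m \<in> S"
    and m: "\<And>x. s * x * m * s = m * s * x * s"
  shows "\<exists>t. m * s * s = t *\<^sub>R (s * s)"
proof -
  note D = hermitian_subalgebraD [OF S(1)]
  note comm = hermitian_subalgebra_commute [OF S(1)]
  define P where "P = S \<inter> {z. \<forall>x. s * x * z * s = z * s * x * s}"
  have P: "hermitian_subalgebra P"
    unfolding hermitian_subalgebra_def
  proof (intro conjI ballI allI)
    show "closed P"
      unfolding P_def by (intro closed_Int D(1) closed_Collect_all closed_Collect_eq continuous_intros)
    show "1 \<in> P"
      using D(2) by (simp add: P_def)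
    fix x y
    assume x: "x \<in> P" and y: "y \<in> P"
    show "x + y \<in> P"
      using x y D(4) by (simp add: P_def distrib_left distrib_right)
    have "s * u * (x * y) * s = x * y * s * u * s" for u
    proof -
      have "y * s = s * y"
        using comm S(2) y by (simp add: P_def)
      then have "s * u * (x * y) * s = (s * u * x * s) * y"
        by (simp add: mult.assoc)
      also have "\<dots> = x * (s * u * y * s)"
        using x \<open>y * s = s * y\<close> by (simp add: P_def mult.assoc)
      also have "\<dots> = x * y * s * u * s"
        using y by (simp add: P_def mult.assoc)
      finally show ?thesis .
    qed
    then show "x * y \<in> P"
      using x y D(6) by (simp add: P_def)
  next
    fix r x
    assume "x \<in> P"
    then show "r *\<^sub>R x \<in> P"
      using D(7) by (simp add: P_def)
  qed (use D(8) in \<open>simp add: P_def\<close>)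
  note DP = hermitian_subalgebraD [OF P]
  have PS: "z \<in> P \<Longrightarrow> z \<in> S" for z
    by (simp add: P_def)
  have mP: "m \<in> P"
    using S(4) m by (simp add: P_def)
  define N where "N = 2 * (norm m + 1)"
  have N: "N > 0"
    by (simp add: N_def add_nonneg_pos)
  define m' where "m' = (1 / N) *\<^sub>R m"
  have m'P: "m' \<in> P"
    unfolding m'_def using DP(7) mP .
  have m'_norm: "norm m' \<le> 1/2"
    using N by (simp add: m'_def divide_le_eq) (simp add: N_def)
  \<comment> \<open>\<open>T1\<close> and \<open>T2\<close> consist of the t at which m' - t,
    respectively t - m', acts on \<open>s\<close> as a square, that is, nonnegatively.\<close>
  define T1 where "T1 = {t. \<exists>r\<in>P. (m' - t *\<^sub>R 1) * s = r * r * s}"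
  define T2 where "T2 = {t. \<exists>r\<in>P. (t *\<^sub>R 1 - m') * s = r * r * s}"
  have cover: "t \<in> T1 \<union> T2" if t: "t \<in> {-1/2..1/2}" for t
  proof -
    define w where "w = m' - t *\<^sub>R 1"
    have wP: "w \<in> P"
      unfolding w_def by (intro DP m'P)
    have "norm w \<le> 1"
      using norm_triangle_ineq4 [of m' "t *\<^sub>R 1"] m'_norm t by (auto simp: w_def)
    then obtain p where p: "p \<in> P" "p * p = w * w" "norm (1 - p) \<le> 1"
      using hermitian_abs [OF P wP] by blast
    obtain r where r: "r \<in> P" "r * r = p"
      using hermitian_sqrt [OF P DP(5) [OF DP(2) p(1)] p(3)] by force
    have "((p + w) * s) * x * ((p - w) * s) = 0" for x
    proof -
      have "p - w \<in> P"
        by (intro DP p(1) wP)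
      then have "(p + w) * (s * x * (p - w) * s) = (p + w) * ((p - w) * s * x * s)"
        by (simp add: P_def)
      also have "\<dots> = ((p + w) * (p - w)) * (s * x * s)"
        by (simp add: mult.assoc)
      also have "(p + w) * (p - w) = 0"
        using p comm [OF PS PS, OF p(1) wP] by (simp add: algebra_simps)
      finally show ?thesis
        by (simp add: mult.assoc)
    qed
    then have "(p + w) * s = 0 \<or> (p - w) * s = 0"
      using prime by blast
    then have "- w * s = r * r * s \<or> w * s = r * r * s"
      by (auto simp: r algebra_simps neg_eq_iff_add_eq_0 add.commute)
    then show ?thesis
      using r(1) unfolding T1_def T2_def w_def by auto
  qed
  have T1: "-1/2 \<in> T1"
  proof -
    have "norm ((1/2) *\<^sub>R 1 - m') \<le> 1"
      using norm_triangle_ineq4 [of "(1/2) *\<^sub>R 1" m'] m'_norm by simp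
    then obtain r where r: "r \<in> P" "r * r = 1 - ((1/2) *\<^sub>R 1 - m')"
      using hermitian_sqrt [OF P DP(5) [OF DP(7) [OF DP(2)] m'P]] by blast
    moreover have "1 - (x - m') = x + m'" if "1 = x + x" for x
      using that by (simp add: algebra_simps)
    then have "1 - ((1/2) *\<^sub>R 1 - m') = (1/2) *\<^sub>R 1 + m'"
      using scaleR_left_distrib [of "1/2" "1/2" "1::'a"] by simp
    ultimately have "r * r = m' - (-1/2) *\<^sub>R 1"
      by simp
    then have "(m' - (-1/2) *\<^sub>R 1) * s = r * r * s"
      by (simp only:)
    then show ?thesis
      using r(1) unfolding T1_def by blast
  qed
  have T2: "1/2 \<in> T2"
  proof -
    have "norm ((1/2) *\<^sub>R 1 + m') \<le> 1"
      using norm_triangle_ineq [of "(1/2) *\<^sub>R 1" m'] m'_norm by simp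
    then obtain r where r: "r \<in> P" "r * r = 1 - ((1/2) *\<^sub>R 1 + m')"
      using hermitian_sqrt [OF P DP(4) [OF DP(7) [OF DP(2)] m'P]] by blast
    moreover have "1 - (x + m') = x - m'" if "1 = x + x" for x
      using that by (simp add: algebra_simps)
    then have "1 - ((1/2) *\<^sub>R 1 + m') = (1/2) *\<^sub>R 1 - m'"
      using scaleR_left_distrib [of "1/2" "1/2" "1::'a"] by simp
    ultimately have "r * r = (1/2) *\<^sub>R 1 - m'"
      by simp
    then have "((1/2) *\<^sub>R 1 - m') * s = r * r * s"
      by (simp only:)
    then show ?thesis
      using r(1) unfolding T2_def by blast
  qed
  \<comment> \<open>Closures suffice here: the estimate \<open>small\<close> only uses points of
    \<open>T1\<close> and \<open>T2\<close> near \<open>t0\<close>.\<close>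
  have "closure T1 \<inter> closure T2 \<inter> {-1/2..1/2::real} \<noteq> {}"
  proof
    assume "closure T1 \<inter> closure T2 \<inter> {-1/2..1/2::real} = {}"
    moreover have "connected {-1/2..1/2::real}"
      by simp
    moreover have "{-1/2..1/2} \<subseteq> closure T1 \<union> closure T2"
      using cover closure_subset by blast
    ultimately have "closure T1 \<inter> {-1/2..1/2} = {} \<or> closure T2 \<inter> {-1/2..1/2} = {}"
      unfolding connected_closed by (meson closed_closure)
    then show False
      using T1 T2 closure_subset by fastforce
  qed
  then obtain t0 where t0: "t0 \<in> closure T1" "t0 \<in> closure T2"
    by blast
  \<comment> \<open>For t1 in \<open>T1\<close> and t2 in \<open>T2\<close> near \<open>t0\<close>,
    the two squares add up to (t2 - t1) s^2, which bounds each by 2 \<delta>; moving from t1 to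
    \<open>t0\<close> costs one more \<delta>.\<close>
  have small: "norm ((m' - t0 *\<^sub>R 1) * s * s) \<le> 3 * norm (s * s) * \<delta>" if \<delta>: "\<delta> > 0" for \<delta>
  proof -
    obtain t1 t2 where t: "t1 \<in> T1" "\<bar>t1 - t0\<bar> < \<delta>" "t2 \<in> T2" "\<bar>t2 - t0\<bar> < \<delta>"
      using t0 \<delta> unfolding closure_approachable dist_real_def by meson
    then obtain r1 r2 where r: "r1 \<in> P" "(m' - t1 *\<^sub>R 1) * s = r1 * r1 * s"
        "r2 \<in> P" "(t2 *\<^sub>R 1 - m') * s = r2 * r2 * s"
      unfolding T1_def T2_def by blast
    have sq: "(r * s) * (r * s) = (r * r * s) * s" if "r \<in> P" for r
    proof -
      have "s * r = r * s"
        using comm S(2) PS that by blast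
      then show ?thesis
        by (metis mult.assoc)
    qed
    have rS: "r1 * s \<in> S" "r2 * s \<in> S"
      by (intro D(6) PS r S(2))+
    have sum: "(r1 * s) * (r1 * s) + (r2 * s) * (r2 * s) = (t2 - t1) *\<^sub>R (s * s)"
      unfolding sq [OF r(1)] sq [OF r(3)] r(2,4) [symmetric] by (simp add: algebra_simps)
    have "norm ((m' - t1 *\<^sub>R 1) * s * s) = (norm (r1 * s))\<^sup>2"
      unfolding r(2) sq [OF r(1), symmetric] using D(8) rS(1) by (simp add: hermitian_norm_square)
    also have "\<dots> \<le> norm ((r1 * s) * (r1 * s) + (r2 * s) * (r2 * s))"
      by (intro norm_le_sum_squares D(8) rS comm)
    also have "\<dots> \<le> 2 * \<delta> * norm (s * s)"
      unfolding sum norm_scaleR using t by (intro mult_right_mono) auto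
    finally have 1: "norm ((m' - t1 *\<^sub>R 1) * s * s) \<le> 2 * \<delta> * norm (s * s)" .
    have "(m' - t0 *\<^sub>R 1) * s * s = (m' - t1 *\<^sub>R 1) * s * s + (t1 - t0) *\<^sub>R (s * s)"
      by (simp add: algebra_simps)
    then have "norm ((m' - t0 *\<^sub>R 1) * s * s) \<le> norm ((m' - t1 *\<^sub>R 1) * s * s) + \<bar>t1 - t0\<bar> * norm (s * s)"
      using norm_triangle_ineq [of "(m' - t1 *\<^sub>R 1) * s * s" "(t1 - t0) *\<^sub>R (s * s)"] by simp
    also have "\<dots> \<le> 2 * \<delta> * norm (s * s) + \<delta> * norm (s * s)"
      using 1 t by (intro add_mono mult_right_mono) auto
    finally show ?thesis
      by (simp add: algebra_simps)
  qed
  have "norm ((m' - t0 *\<^sub>R 1) * s * s) \<le> 0"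
  proof (rule field_le_epsilon)
    fix e :: real
    assume e: "0 < e"
    define \<delta> where "\<delta> = e / (3 * norm (s * s) + 1)"
    have pos: "3 * norm (s * s) + 1 > 0"
      by (simp add: add_nonneg_pos)
    have "3 * norm (s * s) * \<delta> \<le> (3 * norm (s * s) + 1) * \<delta>"
      using e pos by (intro mult_right_mono) (auto simp: \<delta>_def)
    then show "norm ((m' - t0 *\<^sub>R 1) * s * s) \<le> 0 + e"
      using small [of \<delta>] e pos by (simp add: \<delta>_def)
  qed
  then have "m' * s * s = t0 *\<^sub>R (s * s)"
    by (simp add: algebra_simps)
  then have "N *\<^sub>R (m' * s * s) = (N * t0) *\<^sub>R (s * s)"
    by simp
  then show ?thesis
    using N by (simp add: m'_def)
qed

text \<open>After rescaling and possibly changing sign, \<open>h\<close> has a nonzero positive part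
  s, on which some g inverts it. Then m = g k plays the part of the quotient k/h; it is a scalar t
  there, and (k - t h) x s^2 = 0 for all x makes this global.\<close>

lemma hermitian_centrally_closed:
  assumes h: "st h = h" "h \<noteq> 0" and k: "st k = k"
    and hk: "\<And>y. h * y * k = k * y * h"
  shows "\<exists>t. k = t *\<^sub>R h"
proof -
  have core: "\<exists>t. k = t *\<^sub>R h"
    if h: "st h = h" "norm h \<le> 1/2" "\<not> norm (1 + h) \<le> 1" and hk: "\<And>y. h * y * k = k * y * h" for h
  proof -
    obtain S where S: "hermitian_subalgebra S" "h \<in> S" "k \<in> S"
      using hermitian_subalgebra_bicommutant [OF h(1) k] hk [of 1] h(1) k by auto
    note comm = hermitian_subalgebra_commute [OF S(1)]
    obtain s g where sg: "s \<in> S" "g \<in> S" "s \<noteq> 0" "g * h * s = s"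
      using positive_part [OF S(1,2) h(2,3)] by blast
    define m where "m = g * k"
    have mS: "m \<in> S"
      unfolding m_def using hermitian_subalgebraD(6) [OF S(1)] sg S by blast
    have hm: "h * x * m * s = k * x * s" for x
    proof -
      have "h * x * m * s = (h * x * k) * (g * s)"
        by (simp add: m_def comm [OF sg(2) S(3)] mult.assoc)
      also have "\<dots> = k * x * (h * g * s)"
        unfolding hk by (simp add: mult.assoc)
      also have "h * g * s = s"
        using sg(4) by (simp add: comm [OF S(2) sg(2)])
      finally show ?thesis .
    qed
    have "s * x * m * s = m * s * x * s" for x
    proof -
      have "s * x * m * s = (g * s) * (h * x * m * s)"
        using sg(4) comm [OF S(2) sg(1)] by (metis mult.assoc)
      also have "\<dots> = m * s * x * s"
      proof -
        have "(g * s) * (k * x * s) = g * (s * k) * x * s"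
          by (simp add: mult.assoc)
        then show ?thesis
          unfolding hm unfolding m_def comm [OF sg(1) S(3)] by (simp add: mult.assoc)
      qed
      finally show ?thesis .
    qed
    then obtain t where t: "m * s * s = t *\<^sub>R (s * s)"
      using locally_central_scalar [OF S(1) sg(1,3) mS] by blast
    have "(k - t *\<^sub>R h) * x * (s * s) = 0" for x
    proof -
      have "k * x * s * s = h * x * (m * s * s)"
        using arg_cong [OF hm [of x], of "\<lambda>z. z * s"] by (simp add: mult.assoc)
      then show ?thesis
        unfolding t by (simp add: left_diff_distrib mult.assoc)
    qed
    moreover have "s * s \<noteq> 0"
      using hermitian_norm_square [of s] hermitian_subalgebraD(8) [OF S(1) sg(1)] sg(3) by auto
    ultimately have "k - t *\<^sub>R h = 0"
      using prime by blast
    then show ?thesis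
      by auto
  qed
  define c where "c = 1 / (2 * norm h)"
  define h' where "h' = c *\<^sub>R h"
  have h': "st h' = h'" "norm h' \<le> 1/2" "h' \<noteq> 0" "\<And>y. h' * y * k = k * y * h'"
    using h hk by (simp_all add: h'_def c_def st_scaleR)
  show ?thesis
  proof (cases "norm (1 + h') \<le> 1")
    case False
    then obtain t where "k = t *\<^sub>R h'"
      using core [of h'] h' by blast
    then show ?thesis
      by (auto simp: h'_def)
  next
    case True
    then have "\<not> norm (1 + - h') \<le> 1"
      using hermitian_not_both_contractive h' by auto
    then obtain t where "k = t *\<^sub>R (- h')"
      using core [of "- h'"] h' by (auto simp: st_minus)
    then have "k = (- t * c) *\<^sub>R h"
      by (simp add: h'_def)
    then show ?thesis
      by blast
  qed
qed

text \<open>Multiplying by \<open>st a\<close> reduces to the self-adjoint a* a and the element k =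
  a* b. The real and imaginary parts of k, up to real factors, satisfy the same exchange relation
  and are real multiples of a* a.\<close>

theorem centrally_closed:
  assumes a: "a \<noteq> 0" and ab: "\<And>x. a * x * b = b * x * a"
  shows "\<exists>c. b = cs c a"
proof -
  define h where "h = st a * a"
  define k where "k = st a * b"
  have h: "st h = h" "h \<noteq> 0"
    using norm_st_mult [of a] a by (auto simp: h_def st_mult st_st)
  have hk: "h * y * k = k * y * h" for y
    using arg_cong [OF ab [of "y * st a"], of "\<lambda>z. st a * z"] by (simp add: h_def k_def mult.assoc)
  have hk': "h * y * st k = st k * y * h" for y
    using arg_cong [OF hk [of "st y"], of st] by (simp add: st_mult st_st h mult.assoc)
  define k1 where "k1 = k + st k"
  define k2 where "k2 = cs \<i> (k - st k)"
  have "cs (- 1) x = - x" for x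
    using cs_of_real [of "-1" x] by simp
  then have neg: "cs (- \<i>) x = - cs \<i> x" for x
    by (metis cs_cs mult_minus1)
  have "st k1 = k1" "st k2 = k2"
    by (simp_all add: k1_def k2_def st_add st_diff st_st st_cs neg cs_diff_right add.commute)
  moreover have "h * y * k1 = k1 * y * h" "h * y * k2 = k2 * y * h" for y
    by (simp_all add: k1_def k2_def distrib_left distrib_right right_diff_distrib left_diff_distrib
        mult_cs hk hk')
  ultimately obtain t1 t2 where t: "k1 = t1 *\<^sub>R h" "k2 = t2 *\<^sub>R h"
    using hermitian_centrally_closed [OF h] by metis
  have "cs (- \<i>) k2 = k - st k"
    by (simp add: k2_def cs_cs) (use cs_of_real [of 1 "k - st k"] in simp)
  then have "k1 + cs (- \<i>) k2 = 2 *\<^sub>R k"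
    by (simp add: k1_def scaleR_2)
  moreover have "k1 + cs (- \<i>) k2 = cs (t1 - \<i> * t2) h"
    unfolding t cs_of_real [symmetric] cs_cs cs_add_left [symmetric] by simp
  ultimately have "cs (1/2) (cs (t1 - \<i> * t2) h) = cs (1/2) (cs 2 k)"
    using cs_of_real [of 2 k] by simp
  then obtain c where c: "k = cs c h"
    using cs_of_real [of 1 k] by (auto simp: cs_cs)
  have "h * x * (b - cs c a) = 0" for x
  proof -
    have "h * x * b = k * x * a"
      using arg_cong [OF ab [of x], of "\<lambda>z. st a * z"] by (simp add: h_def k_def mult.assoc)
    then show ?thesis
      unfolding c by (simp add: right_diff_distrib mult_cs)
  qed
  then have "b - cs c a = 0"
    using prime [of h "b - cs c a"] h(2) by blast
  then show ?thesis
    by auto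
qed

end

section \<open>Multilinear polynomials\<close>

lemma prod_list_two_factors:
  fixes x y :: "'a::monoid_mult"
  assumes "m \<le> p" "p < q" "q < n"
  shows "prod_list (map (\<lambda>i. if i = p then x else if i = q then y else 1) [m..<n]) = x * y"
proof -
  have "[m..<n] = [m..<p] @ [p..<n]" "[p..<n] = p # [Suc p..<n]"
    using upt_add_eq_append [of m p "n - p"] assms by (simp_all add: upt_conv_Cons)
  moreover have "[Suc p..<n] = [Suc p..<q] @ [q..<n]" "[q..<n] = q # [Suc q..<n]"
    using upt_add_eq_append [of "Suc p" q "n - q"] assms by (simp_all add: upt_conv_Cons)
  ultimately have split: "[m..<n] = [m..<p] @ p # [Suc p..<q] @ q # [Suc q..<n]"
    by simp
  have "prod_list (map (\<lambda>i. if i = p then x else if i = q then y else 1) xs) = 1"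
    if "p \<notin> set xs" "q \<notin> set xs" for xs
    using that by (induction xs) auto
  then show ?thesis
    using assms by (simp add: split)
qed

context complex_algebra
begin

lemma mlpoly_eval_scale: "mlpoly_eval cs d lam (\<lambda>i. cs b (a i)) = cs (b ^ d) (mlpoly_eval cs d lam a)"
proof -
  have "prod_list (map (\<lambda>i. cs b (f i)) xs) = cs (b ^ length xs) (prod_list (map f xs))"
    for f :: "nat \<Rightarrow> 'a" and xs
    by (induction xs) (simp_all add: mult.commute)
  then show ?thesis
    by (simp add: mlpoly_eval_def scale_sum_right mult.commute del: upt_Suc)
qed

text \<open>In the word of \<sigma> the variable with index j stands at place
  \<open>inv \<sigma> j\<close>, so each word collapses to \<open>x * y\<close> or
  \<open>y * x\<close>; the zero total makes the two coefficients opposite.\<close>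

lemma mlpoly_eval_two_variables:
  assumes d: "2 \<le> d"
    and sum_0: "(\<Sum>\<sigma>\<in>{\<sigma>. \<sigma> permutes {1..d}}. lam \<sigma>) = 0"
  shows "mlpoly_eval cs d lam (\<lambda>i. if i = 1 then x else if i = 2 then y else 1)
    = cs (\<Sum>\<sigma>\<in>{\<sigma>. \<sigma> permutes {1..d} \<and> inv \<sigma> 1 < inv \<sigma> 2}. lam \<sigma>) (x * y - y * x)"
proof -
  let ?a = "\<lambda>i. if i = 1 then x else if i = 2 then y else 1"
  let ?S = "{\<sigma>. \<sigma> permutes {1..d}}"
  let ?A = "{\<sigma>. \<sigma> permutes {1..d} \<and> inv \<sigma> 1 < inv \<sigma> 2}"
  let ?B = "{\<sigma>. \<sigma> permutes {1..d} \<and> \<not> inv \<sigma> 1 < inv \<sigma> 2}"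
  have fin: "finite ?S"
    by (rule finite_permutations) simp
  have word: "prod_list (map (\<lambda>i. ?a (\<sigma> i)) [1..<d+1]) = (if inv \<sigma> 1 < inv \<sigma> 2 then x * y else y * x)"
    if \<sigma>: "\<sigma> permutes {1..d}" for \<sigma>
  proof -
    define p q where "p = inv \<sigma> 1" and "q = inv \<sigma> 2"
    have inv: "inv \<sigma> permutes {1..d}"
      using \<sigma> by (rule permutes_inv)
    have pq: "p \<in> {1..d}" "q \<in> {1..d}" "p \<noteq> q"
      unfolding p_def q_def permutes_in_image [OF inv] inj_eq [OF permutes_inj [OF inv]] using d by auto
    have "\<sigma> i = 1 \<longleftrightarrow> i = p" "\<sigma> i = 2 \<longleftrightarrow> i = q" for i
      using permutes_inv_eq [OF \<sigma>, of 1 i] permutes_inv_eq [OF \<sigma>, of 2 i]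
      by (auto simp: p_def q_def)
    then have 1: "(\<lambda>i. ?a (\<sigma> i)) = (\<lambda>i. if i = p then x else if i = q then y else 1)"
      by (auto simp: fun_eq_iff)
    have 2: "(\<lambda>i. if i = p then x else if i = q then y else 1) = (\<lambda>i. if i = q then y else if i = p then x else 1)"
      using pq by auto
    show ?thesis
    proof (cases "p < q")
      case True
      have "prod_list (map (\<lambda>i. ?a (\<sigma> i)) [1..<d+1]) = x * y"
        unfolding 1 by (rule prod_list_two_factors) (use pq True in auto)
      then show ?thesis
        using True by (simp only: p_def q_def if_True)
    next
      case False
      then have "q < p"
        using pq by simp
      have "prod_list (map (\<lambda>i. ?a (\<sigma> i)) [1..<d+1]) = y * x"
        unfolding 1 2 by (rule prod_list_two_factors) (use pq \<open>q < p\<close> in auto)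
      then show ?thesis
        using False by (simp only: p_def q_def if_False)
    qed
  qed
  have split: "(\<Sum>\<sigma>\<in>?S. f \<sigma>) = (\<Sum>\<sigma>\<in>?A. f \<sigma>) + (\<Sum>\<sigma>\<in>?B. f \<sigma>)"
    for f :: "(nat \<Rightarrow> nat) \<Rightarrow> 'c::comm_monoid_add"
  proof -
    have "finite ?A" "finite ?B"
      by (rule finite_subset [OF _ fin], blast)+
    moreover have "?A \<inter> ?B = {}"
      by blast
    ultimately have "(\<Sum>\<sigma>\<in>?A \<union> ?B. f \<sigma>) = (\<Sum>\<sigma>\<in>?A. f \<sigma>) + (\<Sum>\<sigma>\<in>?B. f \<sigma>)"
      by (rule sum.union_disjoint)
    moreover have "?A \<union> ?B = ?S"
      by blast
    ultimately show ?thesis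
      by (simp only:)
  qed
  have "mlpoly_eval cs d lam ?a = (\<Sum>\<sigma>\<in>?S. cs (lam \<sigma>) (if inv \<sigma> 1 < inv \<sigma> 2 then x * y else y * x))"
    unfolding mlpoly_eval_def by (rule sum.cong) (simp_all only: word mem_Collect_eq)
  also have "\<dots> = (\<Sum>\<sigma>\<in>?A. cs (lam \<sigma>) (x * y)) + (\<Sum>\<sigma>\<in>?B. cs (lam \<sigma>) (y * x))"
    unfolding split by (intro arg_cong2 [where f = "(+)"] sum.cong) auto
  also have "\<dots> = cs (\<Sum>\<sigma>\<in>?A. lam \<sigma>) (x * y) + cs (\<Sum>\<sigma>\<in>?B. lam \<sigma>) (y * x)"
    by (simp add: scale_sum_left)
  also have "(\<Sum>\<sigma>\<in>?B. lam \<sigma>) = - (\<Sum>\<sigma>\<in>?A. lam \<sigma>)"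
    using sum_0 unfolding split by (simp add: eq_neg_iff_add_eq_0 add.commute)
  finally show ?thesis
    by (simp add: scale_right_diff_distrib)
qed

end

theorem theorem3p5:
  fixes cs :: "complex \<Rightarrow> 'a::{banach,real_normed_algebra_1} \<Rightarrow> 'a"
    and st :: "'a \<Rightarrow> 'a"
    and d :: nat and lam :: "(nat \<Rightarrow> nat) \<Rightarrow> complex"
    and \<phi> :: "'a \<Rightarrow> 'a"
  assumes "cstar_algebra cs st"
    and "prime_algebra TYPE('a)"
    and "\<not> iso_M2 cs TYPE('a)"
    and "d \<ge> 2"
    and "(\<Sum>\<sigma>\<in>{\<sigma>. \<sigma> permutes {1..d}}. lam \<sigma>) = 0"
    and "(\<Sum>\<sigma>\<in>{\<sigma>. \<sigma> permutes {1..d} \<and> inv \<sigma> 1 < inv \<sigma> 2}. lam \<sigma>) \<noteq> 0"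
    and "continuous_on UNIV \<phi>"
    and "bij \<phi>"
    and "clinear_map cs cs \<phi>"
    and "preserves_zeros cs d lam \<phi>"
    and "\<exists>c. c \<noteq> 0 \<and> \<phi> 1 = cs c 1"
  shows "\<exists>\<alpha> \<theta> \<omega>. (automorphism cs \<theta> \<or> antiautomorphism cs \<theta>) \<and>
           clinear_map cs (*) \<omega> \<and>
           (\<forall>a. \<phi> a = cs \<alpha> (\<theta> a) + cs (\<omega> a) 1)"
proof -
  interpret C: prime_cstar cs st
    by unfold_locales (use assms in auto)
  interpret normed_centrally_closed_prime cs
  proof
    show "a = 0 \<or> b = 0" if "\<And>x. a * x * b = 0" for a b :: 'a
      using C.prime that by blast
    show "\<exists>c. b = cs c a" if "a \<noteq> 0" "\<And>x. a * x * b = b * x * a" for a b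
      using C.centrally_closed that by blast
    show "cs 1 x = x" for x
      using C.cs_of_real [of 1 x] by simp
  qed (simp_all add: C.cs_add_left C.cs_add_right C.cs_cs C.mult_cs C.cs_of_real)
  obtain c where c: "c \<noteq> 0" "\<phi> 1 = cs c 1"
    using assms by blast
  have add: "\<phi> (x + y) = \<phi> x + \<phi> y" and cs: "\<phi> (cs b x) = cs b (\<phi> x)" for b x y
    using assms(9) by (simp_all add: clinear_map_def)
  show ?thesis
  proof (cases "\<forall>t. \<exists>b. t = cs b (1::'a)")
    \<comment> \<open>In the one-dimensional algebra \<phi> is multiplication by
      \<open>c\<close>.\<close>
    case True
    have "\<phi> a = cs c a" for a
    proof -
      obtain b where b: "a = cs b 1"
        using True by blast
      show ?thesis
        unfolding b by (simp add: cs c mult.commute)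
    qed
    moreover have "automorphism cs id" "clinear_map cs (*) (\<lambda>_. 0)"
      by (simp_all add: automorphism_def clinear_map_def)
    ultimately show ?thesis
      by (intro exI [of _ c] exI [of _ id] exI [of _ "\<lambda>_. 0"]) auto
  next
    case False
    have "\<exists>t X Y Z. capelli t (t * t) X Y Z \<noteq> (0::'a)"
    proof (rule ccontr)
      assume *: "\<not> ?thesis"
      have "\<exists>\<alpha> \<beta>. t * t = cs \<alpha> t + cs \<beta> 1" for t
      proof (cases "\<exists>b. t = cs b 1")
        case True
        then obtain b where "t = cs b 1"
          by blast
        then have "t * t = cs b t + cs 0 1"
          by simp
        then show ?thesis
          by blast
      next
        case False
        then show ?thesis
          using capelli_eq_0_imp_quadratic * by blast
      qed
      then have "iso_M2 cs TYPE('a)"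
        using quadratic_imp_M2 False by blast
      then show False
        using assms by blast
    qed
    then obtain t X Y Z where t: "capelli t (t * t) X Y Z \<noteq> (0::'a)"
      by blast
    define \<phi>' where "\<phi>' x = cs (1/c) (\<phi> x)" for x
    have \<phi>: "\<phi> x = cs c (\<phi>' x)" for x
      using c by (simp add: \<phi>'_def)
    have "bij \<phi>'"
    proof -
      have "bij (cs (1/c))"
        using c by (intro o_bij [of "cs c"]) (auto simp: fun_eq_iff)
      then show ?thesis
        using bij_comp [OF assms(8)] by (simp add: \<phi>'_def [abs_def] comp_def)
    qed
    moreover have "\<phi>' (x + y) = \<phi>' x + \<phi>' y" "\<phi>' (cs b x) = cs b (\<phi>' x)" for b x y
      by (simp_all add: \<phi>'_def add cs scale_right_distrib mult.commute)
    moreover have \<phi>'_1: "\<phi>' 1 = 1"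
      using c by (simp add: \<phi>'_def)
    moreover have "\<phi>' (x * x) * \<phi>' x = \<phi>' x * \<phi>' (x * x)" for x
    proof -
      \<comment> \<open>\<open>x * x\<close> and \<open>x\<close> commute, so this is a zero of the
        polynomial. By homogeneity the factor 1/c can be applied in all slots, turning the entries
        \<open>\<phi> 1\<close> back into 1.\<close>
      define a where "a = (\<lambda>i::nat. if i = 1 then x * x else if i = 2 then x else 1)"
      have "mlpoly_eval cs d lam a = 0"
        unfolding a_def mlpoly_eval_two_variables [OF assms(4,5)] by (simp add: mult.assoc)
      then have "mlpoly_eval cs d lam (\<phi> \<circ> a) = 0"
        using assms(10) by (simp add: preserves_zeros_def)
      then have "mlpoly_eval cs d lam (\<lambda>i. cs (1/c) ((\<phi> \<circ> a) i)) = 0"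
        unfolding mlpoly_eval_scale by (simp only: scale_zero_right)
      also have "(\<lambda>i. cs (1/c) ((\<phi> \<circ> a) i)) = (\<lambda>i. if i = 1 then \<phi>' (x * x) else if i = 2 then \<phi>' x else 1)"
        using \<phi>'_1 by (auto simp: a_def \<phi>'_def)
      finally show ?thesis
        unfolding mlpoly_eval_two_variables [OF assms(4,5)] using assms(6) by simp
    qed
    ultimately obtain \<alpha> \<theta> \<omega> where
      *: "automorphism cs \<theta> \<or> antiautomorphism cs \<theta>" "clinear_map cs (*) \<omega>"
        "\<And>a. \<phi>' a = cs \<alpha> (\<theta> a) + cs (\<omega> a) 1"
      using commutativity_preserver [OF _ _ _ _ _ t, of \<phi>'] by blast
    have "\<phi> a = cs (c * \<alpha>) (\<theta> a) + cs (c * \<omega> a) 1" for a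
      unfolding \<phi> * by (simp add: scale_right_distrib)
    moreover have "clinear_map cs (*) (\<lambda>a. c * \<omega> a)"
      using *(2) by (simp add: clinear_map_def algebra_simps)
    ultimately show ?thesis
      using *(1) by blast
  qed
qed

end
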